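(* Assume that $f_i$ is convex and $L$-smooth for all $i=1,\dots,n$ and $f$ is $\mu$-quasi strongly convex, $\mu\ge0$. Consider D-QSGD with delay $\tau\ge1$ and $$0<\gamma\le\min\left\{\frac1{4L\left(1+\frac{2\omega}n\right)},\ \frac1{8L\sqrt{2\tau\left(\tau+1+\frac{2\omega}n\right)}}\right\}.$$ Then, with $D=\frac1n\sum_{i=1}^nD_i$, D-QSGD satisfies the parametric assumption of the context with $A'=L\left(1+\frac{2\omega}n\right)$, $B_1'=B_2'=0$, $D_1'=\frac{(\omega+1)D}n+\frac{2\omega}{n^2}\sum_{i=1}^n\|\nabla f_i(x^* )\|^2$, $\sigma_{1,k}^2\equiv\sigma_{2,k}^2\equiv0$, $\rho_1=\rho_2=1$, $C_1=C_2=0$, $D_2=0$, $G=0$, $F_1=F_2=0$, $$D_3=\frac{3\gamma\tau L}n\left((\omega+1)D+\frac{2\omega}n\sum_{i=1}^n\|\nabla f_i(x^* )\|^2\right),$$ and for all $K\ge0$ $$\mathbf E[f(\bar x^K)-f(x^* )]\le\left(1-\frac{\gamma\mu}2\right)^K\frac{4\|x^0-x^*\|^2}\gamma+4\gamma(D_1'+D_3)$$ when $\mu>0$, and $$\mathbf E[f(\bar x^K)-f(x^* )]\le\frac{4\|x^0-x^*\|^2}{\gamma K}+4\gamma(D_1'+D_3)$$ when $\mu=0$ (right-hand side read as $+\infty$ for $K=0$).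
   Context: $f(x)=\frac1n\sum_{i=1}^nf_i(x)$ on $\mathbb R^d$. A function is $L$-smooth if it is differentiable with $L$-Lipschitz gradient. $f$ is $\mu$-quasi strongly convex if it has a unique minimizer $x^*$ and $f(x^* )\ge f(x)+\langle\nabla f(x),x^*-x\rangle+\frac\mu2\|x-x^*\|^2$ for all $x$. $Q$ is a randomized quantization operator with $\mathbf E[Q(x)]=x$, $\mathbf E\|Q(x)-x\|^2\le\omega\|x\|^2$ for all $x$, $\omega>0$; applications use fresh independent randomness. Delayed framework with integer delay $\tau\ge1$: $x^{k+1}=x^k-\frac1n\sum_iv_i^k$, where $v_i^k=\gamma g_i^{k-\tau}$ if $k\ge\tau$ and $v_i^k=0$ if $k<\tau$; $e_i^{k+1}=e_i^k+\gamma g_i^k-v_i^k$, $e_i^0=0$; $x^0$ deterministic. Here $g_i^k$ is the stochastic vector associated with the point $x^k$. $\mathbf E_k$ is the conditional expectation given $x^k$ and all randomness used to generate $g_i^t$ for $t<k$. D-QSGD: for $k\ge0$ worker $i$ samples, independently of the other workers, $\hat g_i^k$ with $\mathbf E_k[\hat g_i^k]=\nabla f_i(x^k)$, $\mathbf E_k\|\hat g_i^k-\nabla f_i(x^k)\|^2\le D_i$ ($D_i\ge0$ constant), and $g_i^k=Q(\hat g_i^k)-\nabla f_i(x^* )$ (the terms $\nabla f_i(x^* )$ cancel in the average over $i$, so need not be known). Parametric assumption: let $g^k=\frac1n\sum_ig_i^k$, $e^k=\frac1n\sum_ie_i^k$. For all $k,K\ge0$: $\mathbf E_k[g^k]=\nabla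 f(x^k)$; $\mathbf E_k\|g^k\|^2\le2A'(f(x^k)-f(x^* ))+B_1'\sigma_{1,k}^2+B_2'\sigma_{2,k}^2+D_1'$; $\mathbf E_k[\sigma_{1,k+1}^2]\le(1-\rho_1)\sigma_{1,k}^2+2C_1(f(x^k)-f(x^* ))+G\rho_1\sigma_{2,k}^2+D_2$; $\mathbf E_k[\sigma_{2,k+1}^2]\le(1-\rho_2)\sigma_{2,k}^2+2C_2(f(x^k)-f(x^* ))$; $3L\sum_{k=0}^Kw_k\mathbf E\|e^k\|^2\le\frac14\sum_{k=0}^Kw_k\mathbf E[f(x^k)-f(x^* )]+F_1\sigma_{1,0}^2+F_2\sigma_{2,0}^2+\gamma D_3W_K$, where $w_k=(1-\eta)^{-(k+1)}$, $W_K=\sum_{k=0}^Kw_k$, $\eta=\min\{\frac{\gamma\mu}2,\frac{\rho_1}4,\frac{\rho_2}4\}$. Also $\bar x^K=\frac1{W_K}\sum_{k=0}^Kw_kx^k$. *)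

theory Defs
  imports "HOL-Probability.Probability"
begin

section \<open>Functions\<close>

definition grad :: "('a::real_inner \<Rightarrow> real) \<Rightarrow> 'a \<Rightarrow> 'a" where
  "grad f x = (THE D. GDERIV f x :> D)"

definition smooth_with :: "real \<Rightarrow> ('a::euclidean_space \<Rightarrow> real) \<Rightarrow> bool" where
  "smooth_with L f \<longleftrightarrow> (\<forall>x. f differentiable (at x)) \<and> L-lipschitz_on UNIV (grad f)"

definition is_unique_minimizer :: "('a \<Rightarrow> real) \<Rightarrow> 'a \<Rightarrow> bool" where
  "is_unique_minimizer f xs \<longleftrightarrow>
     (\<forall>y. f xs \<le> f y) \<and> (\<forall>z. (\<forall>y. f z \<le> f y) \<longrightarrow> z = xs)"

definition quasi_strongly_convex :: "real \<Rightarrow> ('a::euclidean_space \<Rightarrow> real) \<Rightarrow> 'a \<Rightarrow> bool" where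
  "quasi_strongly_convex \<mu> f xs \<longleftrightarrow>
     is_unique_minimizer f xs \<and>
     (\<forall>x. f xs \<ge> f x + grad f x \<bullet> (xs - x) + \<mu> / 2 * (norm (x - xs))\<^sup>2)"


section \<open>Conditional expectation and conditional independence\<close>

text \<open>
  The Bochner integral and \<^const>\<open>real_cond_exp\<close> return junk values on
  non-integrable arguments, so the predicates below contain integrability explicitly.
\<close>

definition vec_cond_exp ::
  "'w measure \<Rightarrow> 'w measure \<Rightarrow> ('w \<Rightarrow> 'a::euclidean_space) \<Rightarrow> 'w \<Rightarrow> 'a" where
  "vec_cond_exp M F X = (\<lambda>s. \<Sum>b\<in>Basis. real_cond_exp M F (\<lambda>t. X t \<bullet> b) s *\<^sub>R b)"

definition has_cond_exp ::
  "'w measure \<Rightarrow> 'w measure \<Rightarrow> ('w \<Rightarrow> 'a::euclidean_space) \<Rightarrow> ('w \<Rightarrow> 'a) \<Rightarrow> bool" where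
  "has_cond_exp M F X Y \<longleftrightarrow> integrable M X \<and> (AE s in M. vec_cond_exp M F X s = Y s)"

definition cond_exp_le ::
  "'w measure \<Rightarrow> 'w measure \<Rightarrow> ('w \<Rightarrow> real) \<Rightarrow> ('w \<Rightarrow> real) \<Rightarrow> bool" where
  "cond_exp_le M F Z R \<longleftrightarrow> integrable M Z \<and> (AE s in M. real_cond_exp M F Z s \<le> R s)"

text \<open>
  Conditional independence given \<open>F\<close> of the family \<open>X i\<close>, \<open>i \<in> I\<close>. For finite \<open>I\<close>,
  subfamilies are covered by choosing \<open>A i = UNIV\<close>.
\<close>

definition cond_indep_vars ::
  "'w measure \<Rightarrow> 'w measure \<Rightarrow> ('i \<Rightarrow> 'w \<Rightarrow> 'a::euclidean_space) \<Rightarrow> 'i set \<Rightarrow> bool" where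
  "cond_indep_vars M F X I \<longleftrightarrow>
     (\<forall>i\<in>I. X i \<in> borel_measurable M) \<and>
     (\<forall>A. (\<forall>i\<in>I. A i \<in> sets borel) \<longrightarrow>
       (AE s in M. real_cond_exp M F (\<lambda>t. \<Prod>i\<in>I. indicator (A i) (X i t)) s
                 = (\<Prod>i\<in>I. real_cond_exp M F (\<lambda>t. indicator (A i) (X i t)) s)))"


section \<open>Quantization\<close>

text \<open>
  A randomized operator is a jointly measurable map \<open>Q x z\<close> of the point \<open>x\<close> and of a random
  seed \<open>z\<close> with law \<open>N\<close>.
\<close>

definition quantizer ::
  "'z measure \<Rightarrow> ('a::euclidean_space \<Rightarrow> 'z \<Rightarrow> 'a) \<Rightarrow> real \<Rightarrow> bool" where
  "quantizer N Q \<omega> \<longleftrightarrow>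
     prob_space N \<and>
     (\<lambda>(x, z). Q x z) \<in> borel_measurable (borel \<Otimes>\<^sub>M N) \<and>
     (\<forall>x. integrable N (Q x) \<and> (\<integral>z. Q x z \<partial>N) = x) \<and>
     (\<forall>x. integrable N (\<lambda>z. (norm (Q x z - x))\<^sup>2) \<and>
          (\<integral>z. (norm (Q x z - x))\<^sup>2 \<partial>N) \<le> \<omega> * (norm x)\<^sup>2)"


section \<open>The delayed framework\<close>

text \<open>
  Workers are indexed by \<open>{1..n}\<close>; \<open>g i k s\<close> is the vector of worker \<open>i\<close> at step \<open>k\<close> for the
  outcome \<open>s\<close>.
\<close>

definition delayed_update ::
  "real \<Rightarrow> nat \<Rightarrow> (nat \<Rightarrow> nat \<Rightarrow> 'w \<Rightarrow> 'a::euclidean_space) \<Rightarrow> nat \<Rightarrow> nat \<Rightarrow> 'w \<Rightarrow> 'a" where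
  "delayed_update \<gamma> \<tau> g i k s = (if k \<ge> \<tau> then \<gamma> *\<^sub>R g i (k - \<tau>) s else 0)"

definition worker_avg ::
  "nat \<Rightarrow> (nat \<Rightarrow> nat \<Rightarrow> 'w \<Rightarrow> 'a::euclidean_space) \<Rightarrow> nat \<Rightarrow> 'w \<Rightarrow> 'a" where
  "worker_avg n h k s = (1 / real n) *\<^sub>R (\<Sum>i=1..n. h i k s)"

primrec delayed_iterate ::
  "nat \<Rightarrow> real \<Rightarrow> nat \<Rightarrow> (nat \<Rightarrow> nat \<Rightarrow> 'w \<Rightarrow> 'a::euclidean_space) \<Rightarrow> 'a \<Rightarrow> nat \<Rightarrow> 'w \<Rightarrow> 'a" where
  "delayed_iterate n \<gamma> \<tau> g x0 0 = (\<lambda>s. x0)"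
| "delayed_iterate n \<gamma> \<tau> g x0 (Suc k) =
     (\<lambda>s. delayed_iterate n \<gamma> \<tau> g x0 k s - worker_avg n (delayed_update \<gamma> \<tau> g) k s)"

primrec delayed_error ::
  "real \<Rightarrow> nat \<Rightarrow> (nat \<Rightarrow> nat \<Rightarrow> 'w \<Rightarrow> 'a::euclidean_space) \<Rightarrow> nat \<Rightarrow> nat \<Rightarrow> 'w \<Rightarrow> 'a" where
  "delayed_error \<gamma> \<tau> g i 0 = (\<lambda>s. 0)"
| "delayed_error \<gamma> \<tau> g i (Suc k) =
     (\<lambda>s. delayed_error \<gamma> \<tau> g i k s + \<gamma> *\<^sub>R g i k s - delayed_update \<gamma> \<tau> g i k s)"


section \<open>D-QSGD\<close>

text \<open>
  At step \<open>k\<close> worker \<open>i\<close> draws a random element \<open>\<xi> i k\<close> of \<open>S i\<close> to sample its stochastic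
  gradient, and a seed \<open>\<zeta> i k\<close> with law \<open>N\<close> for the quantization. \<open>past k\<close> is the
  \<open>\<sigma>\<close>-algebra of all randomness of the steps before \<open>k\<close>. The iterate \<open>x\<^sup>k\<close> is
  a function of that randomness, so conditioning additionally on it would change nothing.
\<close>

definition past ::
  "'w measure \<Rightarrow> nat \<Rightarrow> (nat \<Rightarrow> 'x measure) \<Rightarrow> 'z measure \<Rightarrow>
   (nat \<Rightarrow> nat \<Rightarrow> 'w \<Rightarrow> 'x) \<Rightarrow> (nat \<Rightarrow> nat \<Rightarrow> 'w \<Rightarrow> 'z) \<Rightarrow> nat \<Rightarrow> 'w measure" where
  "past M n S N \<xi> \<zeta> k = sigma (space M)
     (\<Union>t\<in>{..<k}. \<Union>i\<in>{1..n}. sets (vimage_algebra (space M) (\<xi> i t) (S i))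
                         \<union> sets (vimage_algebra (space M) (\<zeta> i t) N))"

text \<open>The past together with the sampling randomness of worker \<open>i\<close> at step \<open>k\<close>.\<close>

definition past_and_sample ::
  "'w measure \<Rightarrow> nat \<Rightarrow> (nat \<Rightarrow> 'x measure) \<Rightarrow> 'z measure \<Rightarrow>
   (nat \<Rightarrow> nat \<Rightarrow> 'w \<Rightarrow> 'x) \<Rightarrow> (nat \<Rightarrow> nat \<Rightarrow> 'w \<Rightarrow> 'z) \<Rightarrow> nat \<Rightarrow> nat \<Rightarrow> 'w measure" where
  "past_and_sample M n S N \<xi> \<zeta> i k = sigma (space M)
     (sets (past M n S N \<xi> \<zeta> k) \<union> sets (vimage_algebra (space M) (\<xi> i k) (S i)))"

text \<open>All randomness up to and including step \<open>k\<close>, except for the seed \<open>\<zeta> i k\<close>.\<close>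

definition all_but_seed ::
  "'w measure \<Rightarrow> nat \<Rightarrow> (nat \<Rightarrow> 'x measure) \<Rightarrow> 'z measure \<Rightarrow>
   (nat \<Rightarrow> nat \<Rightarrow> 'w \<Rightarrow> 'x) \<Rightarrow> (nat \<Rightarrow> nat \<Rightarrow> 'w \<Rightarrow> 'z) \<Rightarrow> nat \<Rightarrow> nat \<Rightarrow> 'w measure" where
  "all_but_seed M n S N \<xi> \<zeta> i k = sigma (space M)
     (sets (past M n S N \<xi> \<zeta> k)
      \<union> (\<Union>j\<in>{1..n}. sets (vimage_algebra (space M) (\<xi> j k) (S j)))
      \<union> (\<Union>j\<in>{1..n} - {i}. sets (vimage_algebra (space M) (\<zeta> j k) N)))"

definition fresh_seeds ::
  "'w measure \<Rightarrow> nat \<Rightarrow> (nat \<Rightarrow> 'x measure) \<Rightarrow> 'z measure \<Rightarrow>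
   (nat \<Rightarrow> nat \<Rightarrow> 'w \<Rightarrow> 'x) \<Rightarrow> (nat \<Rightarrow> nat \<Rightarrow> 'w \<Rightarrow> 'z) \<Rightarrow> bool" where
  "fresh_seeds M n S N \<xi> \<zeta> \<longleftrightarrow>
     (\<forall>k. \<forall>i\<in>{1..n}.
        \<zeta> i k \<in> measurable M N \<and> distr M N (\<zeta> i k) = N \<and>
        prob_space.indep_set M (sets (all_but_seed M n S N \<xi> \<zeta> i k))
                               (sets (vimage_algebra (space M) (\<zeta> i k) N)))"

text \<open>
  \<open>gh i k\<close> is the stochastic gradient before quantization, \<open>g i k\<close> the vector that worker \<open>i\<close>
  communicates and \<open>x k\<close> the iterate.
\<close>

definition dqsgd ::
  "'w measure \<Rightarrow> nat \<Rightarrow> (nat \<Rightarrow> 'a::euclidean_space \<Rightarrow> real) \<Rightarrow> 'a \<Rightarrow> real \<Rightarrow> nat \<Rightarrow> 'a \<Rightarrow>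
   'z measure \<Rightarrow> ('a \<Rightarrow> 'z \<Rightarrow> 'a) \<Rightarrow> (nat \<Rightarrow> real) \<Rightarrow>
   (nat \<Rightarrow> 'x measure) \<Rightarrow> (nat \<Rightarrow> nat \<Rightarrow> 'w \<Rightarrow> 'x) \<Rightarrow> (nat \<Rightarrow> nat \<Rightarrow> 'w \<Rightarrow> 'z) \<Rightarrow>
   (nat \<Rightarrow> nat \<Rightarrow> 'w \<Rightarrow> 'a) \<Rightarrow> (nat \<Rightarrow> nat \<Rightarrow> 'w \<Rightarrow> 'a) \<Rightarrow> (nat \<Rightarrow> 'w \<Rightarrow> 'a) \<Rightarrow> bool" where
  "dqsgd M n fs xs \<gamma> \<tau> x0 N Q Dw S \<xi> \<zeta> gh g x \<longleftrightarrow>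
     prob_space M \<and>
     g = (\<lambda>i k s. Q (gh i k s) (\<zeta> i k s) - grad (fs i) xs) \<and>
     x = delayed_iterate n \<gamma> \<tau> g x0 \<and>
     fresh_seeds M n S N \<xi> \<zeta> \<and>
     (\<forall>k. \<forall>i\<in>{1..n}.
        \<xi> i k \<in> measurable M (S i) \<and>
        gh i k \<in> borel_measurable (past_and_sample M n S N \<xi> \<zeta> i k) \<and>
        has_cond_exp M (past M n S N \<xi> \<zeta> k) (gh i k) (\<lambda>s. grad (fs i) (x k s)) \<and>
        cond_exp_le M (past M n S N \<xi> \<zeta> k)
          (\<lambda>s. (norm (gh i k s - grad (fs i) (x k s)))\<^sup>2) (\<lambda>s. Dw i)) \<and>
     (\<forall>k. cond_indep_vars M (past M n S N \<xi> \<zeta> k) (\<lambda>i. gh i k) {1..n})"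


section \<open>The parametric assumption\<close>

definition rate :: "real \<Rightarrow> real \<Rightarrow> real \<Rightarrow> real \<Rightarrow> real" where
  "rate \<gamma> \<mu> \<rho>1 \<rho>2 = min (\<gamma> * \<mu> / 2) (min (\<rho>1 / 4) (\<rho>2 / 4))"

definition weight :: "real \<Rightarrow> nat \<Rightarrow> real" where
  "weight \<eta> k = (1 - \<eta>) powi (- (int k + 1))"

definition weight_sum :: "real \<Rightarrow> nat \<Rightarrow> real" where
  "weight_sum \<eta> K = (\<Sum>k=0..K. weight \<eta> k)"

definition weighted_avg ::
  "real \<Rightarrow> (nat \<Rightarrow> 'w \<Rightarrow> 'a::euclidean_space) \<Rightarrow> nat \<Rightarrow> 'w \<Rightarrow> 'a" where
  "weighted_avg \<eta> x K s = (1 / weight_sum \<eta> K) *\<^sub>R (\<Sum>k=0..K. weight \<eta> k *\<^sub>R x k s)"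

text \<open>
  \<open>F k\<close> is the \<open>\<sigma>\<close>-algebra of \<open>\<^bold>E\<^sub>k\<close>; \<open>g\<close> and \<open>e\<close> are already averaged over the workers; the
  random variables \<open>\<sigma>1 k\<close> and \<open>\<sigma>2 k\<close> enter through their squares.
\<close>

definition parametric_assumption ::
  "'w measure \<Rightarrow> (nat \<Rightarrow> 'w measure) \<Rightarrow> ('a::euclidean_space \<Rightarrow> real) \<Rightarrow> 'a \<Rightarrow>
   real \<Rightarrow> real \<Rightarrow> real \<Rightarrow>
   (nat \<Rightarrow> 'w \<Rightarrow> 'a) \<Rightarrow> (nat \<Rightarrow> 'w \<Rightarrow> 'a) \<Rightarrow> (nat \<Rightarrow> 'w \<Rightarrow> 'a) \<Rightarrow>
   (nat \<Rightarrow> 'w \<Rightarrow> real) \<Rightarrow> (nat \<Rightarrow> 'w \<Rightarrow> real) \<Rightarrow>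
   real \<Rightarrow> real \<Rightarrow> real \<Rightarrow> real \<Rightarrow> real \<Rightarrow> real \<Rightarrow> real \<Rightarrow> real \<Rightarrow> real \<Rightarrow> real \<Rightarrow>
   real \<Rightarrow> real \<Rightarrow> real \<Rightarrow> bool" where
  "parametric_assumption M F f xs L \<mu> \<gamma> x g e \<sigma>1 \<sigma>2
     A' B1' B2' D1' \<rho>1 \<rho>2 C1 C2 G D2 F1 F2 D3 \<longleftrightarrow>
   (let \<eta> = rate \<gamma> \<mu> \<rho>1 \<rho>2 in
     (\<forall>k. has_cond_exp M (F k) (g k) (\<lambda>s. grad f (x k s))) \<and>
     (\<forall>k. cond_exp_le M (F k) (\<lambda>s. (norm (g k s))\<^sup>2)
        (\<lambda>s. 2 * A' * (f (x k s) - f xs) + B1' * (\<sigma>1 k s)\<^sup>2 + B2' * (\<sigma>2 k s)\<^sup>2 + D1')) \<and>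
     (\<forall>k. cond_exp_le M (F k) (\<lambda>s. (\<sigma>1 (Suc k) s)\<^sup>2)
        (\<lambda>s. (1 - \<rho>1) * (\<sigma>1 k s)\<^sup>2 + 2 * C1 * (f (x k s) - f xs)
             + G * \<rho>1 * (\<sigma>2 k s)\<^sup>2 + D2)) \<and>
     (\<forall>k. cond_exp_le M (F k) (\<lambda>s. (\<sigma>2 (Suc k) s)\<^sup>2)
        (\<lambda>s. (1 - \<rho>2) * (\<sigma>2 k s)\<^sup>2 + 2 * C2 * (f (x k s) - f xs))) \<and>
     (\<forall>k. integrable M (\<lambda>s. (norm (e k s))\<^sup>2) \<and> integrable M (\<lambda>s. f (x k s) - f xs)) \<and>
     (\<forall>K. AE s in M.
        3 * L * (\<Sum>k=0..K. weight \<eta> k * (\<integral>t. (norm (e k t))\<^sup>2 \<partial>M))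
        \<le> 1 / 4 * (\<Sum>k=0..K. weight \<eta> k * (\<integral>t. f (x k t) - f xs \<partial>M))
           + F1 * (\<sigma>1 0 s)\<^sup>2 + F2 * (\<sigma>2 0 s)\<^sup>2 + \<gamma> * D3 * weight_sum \<eta> K))"

end

theory Submission
  imports Defs
begin

text \<open>
  Write \<open>g\<^sup>k\<close> for the average of the vectors \<open>g i k\<close>, \<open>\<epsilon>\<^sup>k = g\<^sup>k - grad f x\<^sup>k\<close> for its noise
  (\<open>grad_noise\<close>), \<open>e\<^sup>k\<close> for the average error (\<open>avg_error\<close>) and \<open>\<delta>\<^sup>k\<close> for the expected gap
  (\<open>gap\<close>). The variance bound behind \<open>A'\<close> and \<open>D1'\<close> comes from splitting \<open>\<epsilon>\<^sup>k\<close> into quantization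
  and sampling errors of the single workers. These \<open>2 n\<close> vectors are pairwise orthogonal in
  \<open>L\<^sup>2\<close>, even after restriction to an event of the past, so that the second moment of their sum is
  the sum of the second moments (\<open>worker_noise_orthogonal\<close>, \<open>grad_noise_second_moment\<close>). A
  quantization error is orthogonal to everything that does not involve its own seed, because the
  seed can be integrated out with all other randomness frozen (\<open>noise_orthogonal\<close>); two sampling
  errors are orthogonal by conditional independence (\<open>cond_indep_orthogonal\<close>). Convexity and
  smoothness bound the average of \<open>\<parallel>grad (fs i) x - grad (fs i) xs\<parallel>\<^sup>2\<close> by \<open>2 L (f x - f xs)\<close>.

  The error \<open>e\<^sup>k\<close> is \<open>\<gamma>\<close> times the sum of \<open>g\<^sup>t\<close> over the window \<open>k - \<tau> \<le> t < k\<close>. The delay has a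
  benefit here: \<open>x\<^sup>s\<close> depends only on the randomness before step \<open>s - \<tau>\<close>. Hence inside one window no
  iterate depends on any of the noise vectors, every gradient is orthogonal to every \<open>\<epsilon>\<^sup>t\<close>, and
  the gradients contribute at most \<open>\<tau>\<close> times the sum of their second moments while the noise
  contributes only the sum of its variances (\<open>avg_error_second_moment\<close>). The orthogonality avoids a
  factor \<open>2\<close>, which the constant \<open>D3\<close> would not accommodate. Over \<open>\<tau>\<close> steps the weights grow by a
  factor of at most \<open>2\<close>, so the weighted sum of these bounds is absorbed by the weighted gaps, by
  the step size condition (\<open>weighted_error_sum\<close>).

  The convergence rate follows from the virtual iterate \<open>x\<^sup>k - e\<^sup>k\<close>, which performs the undelayed
  step \<open>- \<gamma> g\<^sup>k\<close>. Its expected squared distance to \<open>xs\<close> contracts by the factor \<open>1 - \<gamma> \<mu> / 2\<close> up to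
  a gain \<open>- \<gamma> \<delta>\<^sup>k / 2\<close> and errors in \<open>e\<^sup>k\<close> and in the noise level (\<open>virtual_step\<close>). The weights
  telescope this recursion (\<open>weighted_recursion\<close>), and Jensen's inequality passes from the
  weighted gaps to the averaged iterate (\<open>jensen_gap\<close>).
\<close>

section \<open>Smooth convex functions\<close>

lemma grad_eqI: "GDERIV f x :> D \<Longrightarrow> grad f x = D"
  for f :: "'a::real_inner \<Rightarrow> real"
proof -
  assume D: "GDERIV f x :> D"
  have "D' = D" if "GDERIV f x :> D'" for D'
  proof -
    have "(\<lambda>h. h \<bullet> D') = (\<lambda>h. h \<bullet> D)"
      using has_derivative_unique that D unfolding gderiv_def by blast
    then show ?thesis by (metis inner_commute vector_eq_ldot)
  qed
  with D show ?thesis unfolding grad_def by (blast intro: the_equality)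
qed

lemma GDERIV_grad:
  fixes f :: "'a::euclidean_space \<Rightarrow> real"
  assumes "f differentiable (at x)"
  shows "GDERIV f x :> grad f x"
proof -
  obtain f' where f': "(f has_derivative f') (at x)"
    using assms by (auto simp: differentiable_def)
  interpret linear f' using f' by (rule has_derivative_linear)
  have "f' h = h \<bullet> (\<Sum>b\<in>Basis. f' b *\<^sub>R b)" for h
  proof -
    have "f' h = f' (\<Sum>b\<in>Basis. (h \<bullet> b) *\<^sub>R b)" by (simp add: euclidean_representation)
    also have "\<dots> = h \<bullet> (\<Sum>b\<in>Basis. f' b *\<^sub>R b)"
      by (simp add: sum scale inner_sum_right mult.commute)
    finally show ?thesis .
  qed
  with f' have "GDERIV f x :> (\<Sum>b\<in>Basis. f' b *\<^sub>R b)"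
    unfolding gderiv_def by (metis (no_types, lifting) ext)
  then show ?thesis using grad_eqI by metis
qed

lemma DERIV_along_line:
  fixes f :: "'a::euclidean_space \<Rightarrow> real"
  assumes "\<And>x. f differentiable (at x)"
  shows "((\<lambda>t. f (x + t *\<^sub>R d)) has_real_derivative grad f (x + t *\<^sub>R d) \<bullet> d) (at t)"
proof -
  have "(f has_derivative (\<lambda>h. h \<bullet> grad f (x + t *\<^sub>R d))) (at (x + t *\<^sub>R d))"
    using GDERIV_grad[OF assms] by (simp add: gderiv_def)
  moreover have "((\<lambda>t. x + t *\<^sub>R d) has_derivative (\<lambda>h. h *\<^sub>R d)) (at t)"
    by (auto intro!: derivative_eq_intros)
  ultimately have "((\<lambda>t. f (x + t *\<^sub>R d)) has_derivative
      (\<lambda>h. (h *\<^sub>R d) \<bullet> grad f (x + t *\<^sub>R d))) (at t)"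
    by (rule has_derivative_compose[rotated])
  then show ?thesis
    unfolding has_field_derivative_def by (simp add: mult.commute inner_commute mult_commute_abs)
qed

text \<open>
  The tangent inequality on the real line, applied to the restriction of \<open>f\<close> to a segment.
\<close>

lemma convex_above_tangent:
  fixes f :: "'a::euclidean_space \<Rightarrow> real"
  assumes "convex_on UNIV f" and diff: "\<And>x. f differentiable (at x)"
  shows "f x + grad f x \<bullet> (y - x) \<le> f y"
proof -
  define h where "h t = f (x + t *\<^sub>R (y - x))" for t
  have "convex_on UNIV h"
  proof (rule convex_onI)
    fix t a b :: real assume "0 < t" "t < 1"
    have *: "x + ((1 - t) * a + t * b) *\<^sub>R (y - x) =
        (1 - t) *\<^sub>R (x + a *\<^sub>R (y - x)) + t *\<^sub>R (x + b *\<^sub>R (y - x))"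
      by (simp add: algebra_simps)
    show "h ((1 - t) *\<^sub>R a + t *\<^sub>R b) \<le> (1 - t) * h a + t * h b"
      unfolding h_def real_scaleR_def *
      using \<open>0 < t\<close> \<open>t < 1\<close> by (intro convex_onD[OF assms(1)]) auto
  qed simp
  moreover have "(h has_real_derivative grad f x \<bullet> (y - x)) (at 0 within UNIV)"
    using DERIV_along_line[OF diff, of x "y - x" 0] by (simp add: h_def[abs_def])
  ultimately have "(grad f x \<bullet> (y - x)) * (1 - 0) \<le> h 1 - h 0"
    by (intro convex_on_imp_above_tangent[of UNIV h 0 1]) auto
  then show ?thesis by (simp add: h_def)
qed

lemma smooth_withD:
  assumes "smooth_with L f"
  shows "f differentiable (at x)" "0 \<le> L" "norm (grad f x - grad f y) \<le> L * norm (x - y)"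
  using assms by (auto simp: smooth_with_def lipschitz_on_def dist_norm)

text \<open>
  The function \<open>f (x + t d)\<close> minus its claimed quadratic upper bound is nonincreasing in
  \<open>t \<ge> 0\<close>, because the Lipschitz condition bounds the difference of the directional derivatives.
\<close>

lemma descent:
  fixes f :: "'a::euclidean_space \<Rightarrow> real"
  assumes "smooth_with L f"
  shows "f (x + d) \<le> f x + grad f x \<bullet> d + L / 2 * (norm d)\<^sup>2"
proof -
  note sm = smooth_withD[OF assms]
  define h where "h t = f (x + t *\<^sub>R d) - t * (grad f x \<bullet> d) - t\<^sup>2 * (L / 2 * (norm d)\<^sup>2)" for t
  have "\<exists>y. (h has_real_derivative y) (at t) \<and> y \<le> 0" if t: "0 \<le> t" for t
  proof -
    have "(h has_real_derivative
        grad f (x + t *\<^sub>R d) \<bullet> d - grad f x \<bullet> d - L * t * (norm d)\<^sup>2) (at t)"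
      unfolding h_def
      by (rule derivative_eq_intros DERIV_along_line sm refl | simp)+
    moreover have "grad f (x + t *\<^sub>R d) \<bullet> d - grad f x \<bullet> d \<le> L * t * (norm d)\<^sup>2"
    proof -
      have "(grad f (x + t *\<^sub>R d) - grad f x) \<bullet> d \<le> norm (grad f (x + t *\<^sub>R d) - grad f x) * norm d"
        by (rule norm_cauchy_schwarz)
      also have "\<dots> \<le> L * norm (t *\<^sub>R d) * norm d"
        using sm(3)[of "x + t *\<^sub>R d" x] by (intro mult_right_mono) auto
      finally show ?thesis using t by (simp add: inner_diff_left power2_eq_square mult.assoc)
    qed
    ultimately show ?thesis
      by (intro exI[of _ "grad f (x + t *\<^sub>R d) \<bullet> d - grad f x \<bullet> d - L * t * (norm d)\<^sup>2"]) simp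
  qed
  then have "h 1 \<le> h 0"
    by (rule DERIV_nonpos_imp_nonincreasing[rotated]) auto
  then show ?thesis by (simp add: h_def)
qed

text \<open>
  Minimizing the quadratic upper bound over \<open>d\<close>. The hypothesis is the bound itself, so that the
  lemma also applies to tilted functions whose gradient is \<open>grad f\<close> minus a constant.
\<close>

lemma gradient_step:
  fixes f :: "'a::euclidean_space \<Rightarrow> real"
  assumes "\<And>x d. f (x + d) \<le> f x + G x \<bullet> d + L / 2 * (norm d)\<^sup>2" "L > 0"
  shows "f (x - (1 / L) *\<^sub>R G x) \<le> f x - (norm (G x))\<^sup>2 / (2 * L)"
proof -
  have "f (x - (1 / L) *\<^sub>R G x) \<le> f x + G x \<bullet> (- (1 / L) *\<^sub>R G x) + L / 2 * (norm (- (1 / L) *\<^sub>R G x))\<^sup>2"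
    using assms(1)[of x "- (1 / L) *\<^sub>R G x"] by simp
  also have "\<dots> = f x - (norm (G x))\<^sup>2 / (2 * L)"
    using assms(2) unfolding norm_scaleR power_mult_distrib inner_scaleR_right dot_square_norm
    by (simp add: field_simps power2_eq_square)
  finally show ?thesis .
qed

text \<open>
  Tilting \<open>f\<close> by its tangent at \<open>y\<close> makes \<open>y\<close> a minimizer by convexity, and one gradient step
  from \<open>x\<close> cannot go below the minimum.
\<close>

lemma grad_diff_bound:
  fixes f :: "'a::euclidean_space \<Rightarrow> real"
  assumes "convex_on UNIV f" "smooth_with L f" "L > 0"
  shows "(norm (grad f x - grad f y))\<^sup>2 \<le> 2 * L * (f x - f y - grad f y \<bullet> (x - y))"
proof -
  define h where "h z = f z - grad f y \<bullet> z" for z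
  define G where "G z = grad f z - grad f y" for z
  have "h (z + d) \<le> h z + G z \<bullet> d + L / 2 * (norm d)\<^sup>2" for z d
    using descent[OF assms(2), of z d] by (simp add: h_def G_def inner_add_right inner_diff_left)
  from gradient_step[of h G, OF this \<open>L > 0\<close>, of x]
  have "h (x - (1 / L) *\<^sub>R G x) \<le> h x - (norm (G x))\<^sup>2 / (2 * L)" .
  moreover have "h y \<le> h (x - (1 / L) *\<^sub>R G x)"
    using convex_above_tangent[OF assms(1) smooth_withD(1)[OF assms(2)], of y "x - (1 / L) *\<^sub>R G x"]
    by (simp add: h_def inner_diff_right)
  ultimately have "(norm (G x))\<^sup>2 / (2 * L) \<le> h x - h y" by linarith
  then have "(norm (G x))\<^sup>2 \<le> (h x - h y) * (2 * L)"
    using \<open>L > 0\<close> by (simp add: pos_divide_le_eq)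
  also have "\<dots> = 2 * L * (f x - f y - grad f y \<bullet> (x - y))"
    unfolding h_def inner_diff_right by simp
  finally show ?thesis by (simp only: G_def)
qed

lemma smooth_minimizer:
  fixes f :: "'a::euclidean_space \<Rightarrow> real"
  assumes "smooth_with L f" "L > 0" and min: "\<And>y. f xs \<le> f y"
  shows "(norm (grad f x))\<^sup>2 \<le> 2 * L * (f x - f xs)" "grad f xs = 0"
proof -
  show *: "(norm (grad f x))\<^sup>2 \<le> 2 * L * (f x - f xs)" for x
  proof -
    have "(norm (grad f x))\<^sup>2 / (2 * L) \<le> f x - f xs"
      using gradient_step[of f "grad f", OF descent[OF assms(1)] \<open>L > 0\<close>, of x]
        min[of "x - (1 / L) *\<^sub>R grad f x"] by linarith
    then show ?thesis using \<open>L > 0\<close> by (simp add: field_simps)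
  qed
  from *[of xs] show "grad f xs = 0" by simp
qed

text \<open>
  At distance \<open>1\<close> from the minimizer both conditions compare the gradient norm \<open>p\<close> with the gap:
  together they give \<open>p\<^sup>2 + \<mu> L \<le> 2 L p\<close>, and \<open>2 L p \<le> p\<^sup>2 + L\<^sup>2\<close>.
\<close>

lemma quasi_strong_convexity_le_smoothness:
  fixes f :: "'a::euclidean_space \<Rightarrow> real"
  assumes "smooth_with L f" "L > 0" "quasi_strongly_convex \<mu> f xs" "\<mu> \<ge> 0"
  shows "\<mu> \<le> L"
proof -
  obtain b :: 'a where "b \<in> Basis" using nonempty_Basis by blast
  define x where "x = xs + b"
  have xb: "norm (x - xs) = 1" using \<open>b \<in> Basis\<close> by (simp add: x_def)
  have min: "\<And>y. f xs \<le> f y" and qsc: "f xs \<ge> f x + grad f x \<bullet> (xs - x) + \<mu> / 2 * (norm (x - xs))\<^sup>2"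
    using assms(3) by (auto simp: quasi_strongly_convex_def is_unique_minimizer_def)
  define p where "p = norm (grad f x)"
  have "p\<^sup>2 / (2 * L) \<le> f x - f xs"
    using smooth_minimizer(1)[OF assms(1,2) min, of x] \<open>L > 0\<close> by (simp add: p_def field_simps)
  moreover have "grad f x \<bullet> (x - xs) \<le> p"
    using norm_cauchy_schwarz[of "grad f x" "x - xs"] by (simp add: p_def xb)
  ultimately have "p\<^sup>2 / (2 * L) + \<mu> / 2 \<le> p"
    using qsc by (simp add: xb inner_diff_right)
  then have "p\<^sup>2 + \<mu> * L \<le> 2 * L * p" using \<open>L > 0\<close> by (simp add: field_simps)
  moreover have "2 * L * p \<le> p\<^sup>2 + L * L"
    using zero_le_power2[of "p - L"] by (simp add: power2_eq_square algebra_simps)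
  ultimately have "\<mu> * L \<le> L * L" by linarith
  then show ?thesis using \<open>L > 0\<close> by simp
qed

lemma average_smooth_convex:
  fixes fs :: "nat \<Rightarrow> 'a::euclidean_space \<Rightarrow> real"
  assumes "n \<ge> 1" and f: "f = (\<lambda>y. (1 / real n) * (\<Sum>i=1..n. fs i y))"
    and cvx: "\<And>i. i \<in> {1..n} \<Longrightarrow> convex_on UNIV (fs i)"
    and sm: "\<And>i. i \<in> {1..n} \<Longrightarrow> smooth_with L (fs i)"
  shows "convex_on UNIV f" "smooth_with L f" "grad f x = (1 / real n) *\<^sub>R (\<Sum>i=1..n. grad (fs i) x)"
proof -
  have G: "GDERIV f x :> (1 / real n) *\<^sub>R (\<Sum>i=1..n. grad (fs i) x)" for x
  proof -
    have "((\<lambda>y. (1 / real n) * (\<Sum>i=1..n. fs i y)) has_derivative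
        (\<lambda>h. (1 / real n) * (\<Sum>i=1..n. h \<bullet> grad (fs i) x))) (at x)"
      using GDERIV_grad[OF smooth_withD(1)[OF sm]]
      by (intro has_derivative_mult_right has_derivative_sum) (auto simp: gderiv_def)
    then show ?thesis by (simp add: f gderiv_def inner_sum_right)
  qed
  show grad: "grad f x = (1 / real n) *\<^sub>R (\<Sum>i=1..n. grad (fs i) x)" for x
    by (rule grad_eqI[OF G])
  show "smooth_with L f"
    unfolding smooth_with_def
  proof (intro conjI allI lipschitz_onI)
    show "f differentiable (at x)" for x
      using G[of x] by (auto simp: gderiv_def differentiable_def)
    show "0 \<le> L" using smooth_withD(2)[OF sm, of 1] \<open>n \<ge> 1\<close> by simp
    show "dist (grad f x) (grad f y) \<le> L * dist x y" for x y
    proof -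
      have "norm (\<Sum>i=1..n. grad (fs i) x - grad (fs i) y) \<le> (\<Sum>i=1..n. L * norm (x - y))"
        by (intro sum_norm_le smooth_withD(3) sm)
      then show ?thesis
        using \<open>n \<ge> 1\<close>
        by (simp add: grad dist_norm field_simps flip: scaleR_diff_right sum_subtractf)
    qed
  qed
  have "convex_on UNIV (\<lambda>y. \<Sum>i\<in>{1..n}. fs i y)"
  proof -
    have "convex_on UNIV (\<lambda>y. \<Sum>i\<in>I. fs i y)" if "finite I" "I \<subseteq> {1..n}" for I
      using that
    proof (induction I rule: finite_induct)
      case empty
      then show ?case by (simp add: convex_on_def)
    next
      case (insert i I)
      then show ?case by (simp add: convex_on_add cvx)
    qed
    then show ?thesis by blast
  qed
  then show "convex_on UNIV f" unfolding f by (intro convex_on_cmul) auto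
qed

lemma two_inner_le: "2 * \<bar>x \<bullet> y\<bar> \<le> (norm x)\<^sup>2 + (norm y)\<^sup>2"
  for x y :: "'a::real_inner"
proof -
  have "\<bar>x \<bullet> y\<bar> \<le> norm x * norm y" by (rule Cauchy_Schwarz_ineq2)
  then show ?thesis using sum_squares_bound[of "norm x" "norm y"] by simp
qed

lemma norm_add_sq_le: "(norm (x + y))\<^sup>2 \<le> 2 * (norm x)\<^sup>2 + 2 * (norm y)\<^sup>2"
  for x y :: "'a::real_inner"
  using two_inner_le[of x y]
  unfolding power2_norm_eq_inner inner_add_left inner_add_right inner_commute[of y x] by linarith

text \<open>
  The drift of the virtual iterate \<open>y - e\<close>, which moves along the gradient at the actual iterate
  \<open>y\<close>. The mismatch \<open>e \<bullet> grad f y\<close> is split by Young's inequality so that half of the gap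
  survives, and \<open>\<mu> \<le> L\<close> merges the two error terms into \<open>3 L\<close>, the constant in the parametric
  assumption.
\<close>

lemma virtual_step_descent:
  fixes f :: "'a::euclidean_space \<Rightarrow> real"
  assumes "smooth_with L f" "L > 0" "quasi_strongly_convex \<mu> f xs" "\<mu> \<ge> 0"
  shows "- 2 * ((y - e - xs) \<bullet> grad f y) \<le> - (f y - f xs) - \<mu> / 2 * (norm (y - e - xs))\<^sup>2 + 3 * L * (norm e)\<^sup>2"
proof -
  have min: "\<And>z. f xs \<le> f z" and qsc: "f xs \<ge> f y + grad f y \<bullet> (xs - y) + \<mu> / 2 * (norm (y - xs))\<^sup>2"
    using assms(3) by (auto simp: quasi_strongly_convex_def is_unique_minimizer_def)
  have A: "\<mu> / 2 * (norm (y - e - xs))\<^sup>2 \<le> \<mu> * (norm (y - xs))\<^sup>2 + \<mu> * (norm e)\<^sup>2"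
    using mult_left_mono[OF norm_add_sq_le[of "y - xs" "- e"], of "\<mu> / 2"] assms(4)
    by (simp add: algebra_simps)
  have "2 * (e \<bullet> grad f y) \<le> 2 * L * (norm e)\<^sup>2 + (norm (grad f y))\<^sup>2 / (2 * L)"
  proof -
    have "0 \<le> (norm ((2 * L) *\<^sub>R e - grad f y))\<^sup>2" by simp
    also have "\<dots> = (2 * L) * (2 * L * (norm e)\<^sup>2 - 2 * (e \<bullet> grad f y)) + (norm (grad f y))\<^sup>2"
      unfolding power2_norm_eq_inner
      by (simp add: inner_diff_left inner_diff_right inner_commute algebra_simps)
    finally have "(2 * L) * (2 * (e \<bullet> grad f y) - 2 * L * (norm e)\<^sup>2) \<le> (norm (grad f y))\<^sup>2"
      by (simp add: algebra_simps)
    then have "2 * (e \<bullet> grad f y) - 2 * L * (norm e)\<^sup>2 \<le> (norm (grad f y))\<^sup>2 / (2 * L)"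
      using assms(2) by (simp add: pos_le_divide_eq mult.commute)
    then show ?thesis by simp
  qed
  moreover have "(norm (grad f y))\<^sup>2 / (2 * L) \<le> f y - f xs"
    using smooth_minimizer(1)[OF assms(1,2) min, of y] assms(2) by (simp add: pos_divide_le_eq mult.commute)
  moreover have "\<mu> * (norm e)\<^sup>2 \<le> L * (norm e)\<^sup>2"
    using quasi_strong_convexity_le_smoothness[OF assms] by (intro mult_right_mono) auto
  moreover have "(y - e - xs) \<bullet> grad f y = - (grad f y \<bullet> (xs - y)) - e \<bullet> grad f y"
    by (simp add: inner_diff_left inner_diff_right inner_commute)
  ultimately show ?thesis using A qsc by linarith
qed

section \<open>Square integrable random vectors\<close>

text \<open>
  Membership in \<open>L\<^sup>2\<close>, for functions rather than for classes modulo null sets, since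
  measurability with respect to sub-\<open>\<sigma>\<close>-algebras is not stable under changes on null sets.
\<close>

definition sq_int :: "'w measure \<Rightarrow> ('w \<Rightarrow> 'a::euclidean_space) \<Rightarrow> bool" where
  "sq_int M X \<longleftrightarrow> X \<in> borel_measurable M \<and> integrable M (\<lambda>s. (norm (X s))\<^sup>2)"

lemma sq_int_measurable: "sq_int M X \<Longrightarrow> X \<in> borel_measurable M"
  and sq_int_integrable_sq: "sq_int M X \<Longrightarrow> integrable M (\<lambda>s. (norm (X s))\<^sup>2)"
  by (auto simp: sq_int_def)

lemma sq_int_dominated:
  assumes "sq_int M X" "Y \<in> borel_measurable M" "\<And>s. norm (Y s) \<le> norm (X s)"
  shows "sq_int M Y"
proof -
  have "integrable M (\<lambda>s. (norm (Y s))\<^sup>2)"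
    by (rule Bochner_Integration.integrable_bound[OF sq_int_integrable_sq[OF assms(1)]])
      (use assms in \<open>auto intro!: AE_I2 power_mono\<close>)
  with assms(2) show ?thesis by (simp add: sq_int_def)
qed

lemma sq_int_add:
  assumes "sq_int M X" "sq_int M Y"
  shows "sq_int M (\<lambda>s. X s + Y s)"
proof -
  note [measurable] = sq_int_measurable[OF assms(1)] sq_int_measurable[OF assms(2)]
  have "integrable M (\<lambda>s. 2 * (norm (X s))\<^sup>2 + 2 * (norm (Y s))\<^sup>2)"
    using assms by (auto simp: sq_int_def)
  then have "integrable M (\<lambda>s. (norm (X s + Y s))\<^sup>2)"
    by (rule Bochner_Integration.integrable_bound) (auto intro!: AE_I2 norm_add_sq_le)
  then show ?thesis by (simp add: sq_int_def)
qed

lemma sq_int_scaleR: "sq_int M X \<Longrightarrow> sq_int M (\<lambda>s. c *\<^sub>R X s)"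
  by (auto simp: sq_int_def power_mult_distrib)

lemma sq_int_diff:
  assumes "sq_int M X" "sq_int M Y"
  shows "sq_int M (\<lambda>s. X s - Y s)"
  using sq_int_add[OF assms(1) sq_int_scaleR[OF assms(2), of "-1"]] by simp

lemma sq_int_sum: "(\<And>i. i \<in> I \<Longrightarrow> sq_int M (X i)) \<Longrightarrow> sq_int M (\<lambda>s. \<Sum>i\<in>I. X i s)"
  by (induction I rule: infinite_finite_induct) (auto intro: sq_int_add simp: sq_int_def[of _ "\<lambda>_. 0"])

lemma sq_int_indicator:
  assumes "sq_int M X" "C \<in> sets M"
  shows "sq_int M (\<lambda>s. indicator C s *\<^sub>R X s)"
  by (rule sq_int_dominated[OF assms(1)])
    (use assms sq_int_measurable in \<open>auto simp: indicator_def intro!: borel_measurable_scaleR\<close>)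

lemma sq_int_component:
  "sq_int M X \<Longrightarrow> b \<in> Basis \<Longrightarrow> sq_int M (\<lambda>s. X s \<bullet> b)"
  by (rule sq_int_dominated[where X=X]) (auto dest: sq_int_measurable simp: Basis_le_norm)

lemma integrable_inner:
  assumes "sq_int M X" "sq_int M Y"
  shows "integrable M (\<lambda>s. X s \<bullet> Y s)"
proof -
  note [measurable] = sq_int_measurable[OF assms(1)] sq_int_measurable[OF assms(2)]
  have "integrable M (\<lambda>s. (norm (X s))\<^sup>2 + (norm (Y s))\<^sup>2)"
    using assms by (auto simp: sq_int_def)
  moreover have "\<bar>x \<bullet> y\<bar> \<le> (norm x)\<^sup>2 + (norm y)\<^sup>2" for x y :: 'b
    using two_inner_le[of x y] by linarith
  ultimately show ?thesis
    using Bochner_Integration.integrable_bound[of M "\<lambda>s. (norm (X s))\<^sup>2 + (norm (Y s))\<^sup>2" "\<lambda>s. X s \<bullet> Y s"]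
    by simp
qed

lemma integrable_mult_sq_int:
  "sq_int M X \<Longrightarrow> sq_int M Y \<Longrightarrow> integrable M (\<lambda>s. X s * Y s)" for X Y :: "'w \<Rightarrow> real"
  using integrable_inner[of M X Y] by simp

context finite_measure
begin

lemma sq_int_const: "sq_int M (\<lambda>s. c)"
  by (simp add: sq_int_def)

lemma sq_int_integrable: 
  assumes "sq_int M X" shows "integrable M X"
proof -
  have "norm v \<le> 1 + (norm v)\<^sup>2" for v :: 'b
    using two_inner_le[of 1 "norm v"] by (simp, smt (verit) norm_ge_zero)
  moreover have "integrable M (\<lambda>s. 1 + (norm (X s))\<^sup>2)"
    using assms by (simp add: sq_int_def)
  ultimately show ?thesis
    using Bochner_Integration.integrable_bound[of M "\<lambda>s. 1 + (norm (X s))\<^sup>2" X]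
      sq_int_measurable[OF assms] by simp
qed

lemma sq_int_lipschitz:
  fixes h :: "'b::euclidean_space \<Rightarrow> 'c::euclidean_space"
  assumes "sq_int M X" "h \<in> borel_measurable borel"
    "\<And>x y. norm (h x - h y) \<le> L * norm (x - y)"
  shows "sq_int M (\<lambda>s. h (X s))"
proof -
  have "sq_int M (\<lambda>s. (\<bar>L\<bar> * norm (X s)) + norm (h 0))"
    by (intro sq_int_add sq_int_const) (use assms(1) in \<open>auto simp: sq_int_def power_mult_distrib\<close>)
  moreover have "norm (h x) \<le> norm (\<bar>L\<bar> * norm x + norm (h 0))" for x
  proof -
    have "norm (h x) \<le> norm (h x - h 0) + norm (h 0)" by (metis diff_add_cancel norm_triangle_ineq)
    also have "norm (h x - h 0) \<le> L * norm x" using assms(3)[of x 0] by simp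
    also have "\<dots> \<le> \<bar>L\<bar> * norm x" by (intro mult_right_mono) auto
    finally show ?thesis by simp
  qed
  ultimately show ?thesis
    using assms(2) sq_int_measurable[OF assms(1)] by (elim sq_int_dominated) auto
qed

end

lemma pythagoras:
  assumes "finite I" and sq: "\<And>i. i \<in> I \<Longrightarrow> sq_int M (X i)"
    and orth: "\<And>i j. i \<in> I \<Longrightarrow> j \<in> I \<Longrightarrow> i \<noteq> j \<Longrightarrow> (\<integral>s. X i s \<bullet> X j s \<partial>M) = 0"
  shows "(\<integral>s. (norm (\<Sum>i\<in>I. X i s))\<^sup>2 \<partial>M) = (\<Sum>i\<in>I. \<integral>s. (norm (X i s))\<^sup>2 \<partial>M)"
proof -
  have "(\<integral>s. (norm (\<Sum>i\<in>I. X i s))\<^sup>2 \<partial>M) = (\<integral>s. (\<Sum>i\<in>I. \<Sum>j\<in>I. X i s \<bullet> X j s) \<partial>M)"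
    unfolding power2_norm_eq_inner inner_sum_left
    unfolding inner_sum_right by simp
  also have "\<dots> = (\<Sum>i\<in>I. \<Sum>j\<in>I. \<integral>s. X i s \<bullet> X j s \<partial>M)"
    by (simp add: Bochner_Integration.integral_sum integrable_inner sq)
  also have "\<dots> = (\<Sum>i\<in>I. \<Sum>j\<in>I. if j = i then \<integral>s. (norm (X i s))\<^sup>2 \<partial>M else 0)"
    by (intro sum.cong refl) (auto simp: orth power2_norm_eq_inner)
  also have "\<dots> = (\<Sum>i\<in>I. \<integral>s. (norm (X i s))\<^sup>2 \<partial>M)"
    using \<open>finite I\<close> by simp
  finally show ?thesis .
qed

lemma integral_norm_add_sq:
  assumes "sq_int M X" "sq_int M Y"
  shows "(\<integral>s. (norm (X s + Y s))\<^sup>2 \<partial>M) =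
     (\<integral>s. (norm (X s))\<^sup>2 \<partial>M) + 2 * (\<integral>s. X s \<bullet> Y s \<partial>M) + (\<integral>s. (norm (Y s))\<^sup>2 \<partial>M)"
proof -
  have "(\<integral>s. (norm (X s + Y s))\<^sup>2 \<partial>M) =
     (\<integral>s. (norm (X s))\<^sup>2 + 2 * (X s \<bullet> Y s) + (norm (Y s))\<^sup>2 \<partial>M)"
    unfolding power2_norm_eq_inner inner_add_left inner_add_right
    by (intro Bochner_Integration.integral_cong) (simp_all add: inner_commute)
  also have "\<dots> = (\<integral>s. (norm (X s))\<^sup>2 \<partial>M) + 2 * (\<integral>s. X s \<bullet> Y s \<partial>M) + (\<integral>s. (norm (Y s))\<^sup>2 \<partial>M)"
    using assms by (simp add: integrable_inner sq_int_integrable_sq)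
  finally show ?thesis .
qed

lemma norm_indicator_sq: "(norm (indicator C s *\<^sub>R v))\<^sup>2 = indicator C s * (norm v)\<^sup>2"
  for v :: "'a::real_normed_vector"
  by (simp add: indicator_def)

lemma norm_sum_sq_le: "(norm (\<Sum>i\<in>I. v i))\<^sup>2 \<le> real (card I) * (\<Sum>i\<in>I. (norm (v i))\<^sup>2)"
proof -
  have "(norm (\<Sum>i\<in>I. v i))\<^sup>2 \<le> (\<Sum>i\<in>I. norm (v i))\<^sup>2"
    by (intro power_mono norm_sum) simp
  also have "\<dots> \<le> (\<Sum>i\<in>I. (norm (v i))\<^sup>2) * real (card I)"
    by (rule sum_squared_le_sum_of_squares)
  finally show ?thesis by (simp add: mult.commute)
qed

section \<open>Conditional expectations\<close>

lemma subalgebra_sets: "subalgebra M F \<Longrightarrow> C \<in> sets F \<Longrightarrow> C \<in> sets M"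
  by (auto simp: subalgebra_def)

context finite_measure_subalgebra
begin

text \<open>
  The set on which the inequality fails is itself an event of \<open>F\<close>, so the hypothesis forces it
  to be a null set.
\<close>

lemma cond_exp_leI:
  assumes Z: "integrable M Z" and R: "integrable M R" "R \<in> borel_measurable F"
    and le: "\<And>C. C \<in> sets F \<Longrightarrow> (\<integral>s. indicator C s * Z s \<partial>M) \<le> (\<integral>s. indicator C s * R s \<partial>M)"
  shows "cond_exp_le M F Z R"
proof -
  let ?E = "real_cond_exp M F Z"
  define C where "C = {s\<in>space F. R s < ?E s}"
  have C: "C \<in> sets F" unfolding C_def using R(2) by measurable
  note CM = subalgebra_sets[OF subalg C]
  have int: "integrable M (\<lambda>s. indicator C s * (?E s - R s))"
    using integrable_mult_indicator[OF CM, of "\<lambda>s. ?E s - R s"] real_cond_exp_int(1)[OF Z] R(1) by simp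
  have iR: "integrable M (\<lambda>s. indicator C s * R s)" and iZ: "integrable M (\<lambda>s. indicator C s * Z s)"
    and iE: "integrable M (\<lambda>s. indicator C s * ?E s)"
    using integrable_mult_indicator[OF CM, of R] integrable_mult_indicator[OF CM, of Z]
      integrable_mult_indicator[OF CM, of ?E] real_cond_exp_int(1)[OF Z] R(1) Z by auto
  have "(\<integral>s. indicator C s * (?E s - R s) \<partial>M) =
      (\<integral>s. indicator C s * ?E s \<partial>M) - (\<integral>s. indicator C s * R s \<partial>M)"
    using iE iR by (simp add: right_diff_distrib)
  also have "(\<integral>s. indicator C s * ?E s \<partial>M) = (\<integral>s. indicator C s * Z s \<partial>M)"
    using iZ C Z by (intro real_cond_exp_intg(2)) auto
  finally have "(\<integral>s. indicator C s * (?E s - R s) \<partial>M) \<le> 0" using le[OF C] by simp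
  moreover have nonneg: "0 \<le> indicator C s * (?E s - R s)" for s
    by (auto simp: C_def indicator_def)
  ultimately have "(\<integral>s. indicator C s * (?E s - R s) \<partial>M) = 0"
    by (simp add: antisym Bochner_Integration.integral_nonneg)
  then have "AE s in M. indicator C s * (?E s - R s) = 0"
    using integral_nonneg_eq_0_iff_AE[OF int] nonneg by simp
  then have "AE s in M. ?E s \<le> R s"
    using AE_space
  proof eventually_elim
    case (elim s)
    moreover have "s \<in> space F" using elim(2) subalg by (simp add: subalgebra_def)
    ultimately show ?case by (auto simp: C_def indicator_def split: if_splits)
  qed
  with Z show ?thesis by (simp add: cond_exp_le_def)
qed

lemma cond_exp_leD:
  assumes "cond_exp_le M F Z R" "integrable M R" "C \<in> sets F"
  shows "(\<integral>s. indicator C s * Z s \<partial>M) \<le> (\<integral>s. indicator C s * R s \<partial>M)"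
proof -
  let ?E = "real_cond_exp M F Z"
  have Z: "integrable M Z" and E: "AE s in M. ?E s \<le> R s"
    using assms(1) by (auto simp: cond_exp_le_def)
  note CM = subalgebra_sets[OF subalg assms(3)]
  have iR: "integrable M (\<lambda>s. indicator C s * R s)" and iZ: "integrable M (\<lambda>s. indicator C s * Z s)"
    and iE: "integrable M (\<lambda>s. indicator C s * ?E s)"
    using integrable_mult_indicator[OF CM, of R] integrable_mult_indicator[OF CM, of Z]
      integrable_mult_indicator[OF CM, of ?E] real_cond_exp_int(1)[OF Z] assms(2) Z by auto
  have "(\<integral>s. indicator C s * Z s \<partial>M) = (\<integral>s. indicator C s * ?E s \<partial>M)"
    using iZ assms(3) Z by (intro real_cond_exp_intg(2)[symmetric]) auto
  also have "\<dots> \<le> (\<integral>s. indicator C s * R s \<partial>M)"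
    using iE iR by (rule integral_mono_AE) (use E in \<open>auto simp: indicator_def\<close>)
  finally show ?thesis .
qed

lemma has_cond_expD_component:
  assumes "has_cond_exp M F X Y" "b \<in> Basis"
  shows "AE s in M. real_cond_exp M F (\<lambda>t. X t \<bullet> b) s = Y s \<bullet> b"
proof -
  have "AE s in M. vec_cond_exp M F X s = Y s" using assms(1) by (simp add: has_cond_exp_def)
  then show ?thesis
  proof eventually_elim
    case (elim s)
    have "real_cond_exp M F (\<lambda>t. X t \<bullet> b) s = vec_cond_exp M F X s \<bullet> b"
      using assms(2) by (simp add: vec_cond_exp_def)
    with elim show ?case by simp
  qed
qed

lemma has_cond_expI:
  assumes X: "integrable M X" and Y: "integrable M Y" "Y \<in> borel_measurable F"
    and eq: "\<And>C b. C \<in> sets F \<Longrightarrow> b \<in> Basis \<Longrightarrow>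
      (\<integral>s. indicator C s * (X s \<bullet> b) \<partial>M) = (\<integral>s. indicator C s * (Y s \<bullet> b) \<partial>M)"
  shows "has_cond_exp M F X Y"
proof -
  have "AE s in M. real_cond_exp M F (\<lambda>t. X t \<bullet> b) s = Y s \<bullet> b" if "b \<in> Basis" for b
    using X Y eq that by (intro real_cond_exp_charact) (auto simp: set_lebesgue_integral_def)
  then have "AE s in M. \<forall>b\<in>Basis. real_cond_exp M F (\<lambda>t. X t \<bullet> b) s = Y s \<bullet> b"
    by (intro AE_finite_allI) auto
  then have "AE s in M. vec_cond_exp M F X s = Y s"
    by eventually_elim (simp add: vec_cond_exp_def euclidean_representation)
  with X show ?thesis by (simp add: has_cond_exp_def)
qed

text \<open>
  The pull-out property, componentwise.
\<close>

lemma has_cond_expD: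
  assumes XY: "has_cond_exp M F X Y" and sq: "sq_int M X" "sq_int M Y" "sq_int M Z"
    and Z: "Z \<in> borel_measurable F"
  shows "(\<integral>s. Z s \<bullet> X s \<partial>M) = (\<integral>s. Z s \<bullet> Y s \<partial>M)"
proof -
  have *: "(\<integral>s. (Z s \<bullet> b) * (X s \<bullet> b) \<partial>M) = (\<integral>s. (Z s \<bullet> b) * (Y s \<bullet> b) \<partial>M)" if b: "b \<in> Basis" for b
  proof -
    have "(\<integral>s. (Z s \<bullet> b) * (X s \<bullet> b) \<partial>M) = (\<integral>s. (Z s \<bullet> b) * real_cond_exp M F (\<lambda>t. X t \<bullet> b) s \<partial>M)"
      using Z sq b sq_int_measurable
      by (intro real_cond_exp_intg(2)[symmetric] integrable_mult_sq_int sq_int_component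
          borel_measurable_inner) auto
    also have "\<dots> = (\<integral>s. (Z s \<bullet> b) * (Y s \<bullet> b) \<partial>M)"
      using Z sq b sq_int_measurable has_cond_expD_component[OF XY b]
        measurable_from_subalg[OF subalg Z] measurable_from_subalg[OF subalg borel_measurable_cond_exp]
      by (intro integral_cong_AE borel_measurable_times borel_measurable_inner) auto
    finally show ?thesis .
  qed
  have int: "integrable M (\<lambda>s. (Z s \<bullet> b) * (X s \<bullet> b))" "integrable M (\<lambda>s. (Z s \<bullet> b) * (Y s \<bullet> b))"
    if "b \<in> Basis" for b
    using sq that by (auto intro!: integrable_mult_sq_int sq_int_component)
  have "(\<integral>s. Z s \<bullet> X s \<partial>M) = (\<integral>s. (\<Sum>b\<in>Basis. (Z s \<bullet> b) * (X s \<bullet> b)) \<partial>M)"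
    by (intro Bochner_Integration.integral_cong refl euclidean_inner)
  also have "\<dots> = (\<Sum>b\<in>Basis. \<integral>s. (Z s \<bullet> b) * (X s \<bullet> b) \<partial>M)"
    by (intro Bochner_Integration.integral_sum int)
  also have "\<dots> = (\<Sum>b\<in>Basis. \<integral>s. (Z s \<bullet> b) * (Y s \<bullet> b) \<partial>M)"
    by (intro sum.cong refl *)
  also have "\<dots> = (\<integral>s. (\<Sum>b\<in>Basis. (Z s \<bullet> b) * (Y s \<bullet> b)) \<partial>M)"
    by (intro Bochner_Integration.integral_sum[symmetric] int)
  also have "\<dots> = (\<integral>s. Z s \<bullet> Y s \<partial>M)"
    by (intro Bochner_Integration.integral_cong refl euclidean_inner[symmetric])
  finally show ?thesis .
qed

end

text \<open>
  The hypothesis says that \<open>W\<close> has conditional expectation \<open>0\<close> given \<open>X\<close>. Passing through the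
  conditional expectation replaces a monotone class argument that would extend the hypothesis from
  indicators to arbitrary functions of \<open>X\<close>.
\<close>

lemma (in finite_measure) orthogonal_to_functions_of:
  fixes W :: "'a \<Rightarrow> real" and u :: "'b::euclidean_space \<Rightarrow> real"
  assumes W: "integrable M W" and X: "X \<in> borel_measurable M" and u: "u \<in> borel_measurable borel"
    and int: "integrable M (\<lambda>s. W s * u (X s))"
    and orth: "\<And>A. A \<in> sets borel \<Longrightarrow> (\<integral>s. W s * indicator A (X s) \<partial>M) = 0"
  shows "(\<integral>s. W s * u (X s) \<partial>M) = 0"
proof -
  define G where "G = vimage_algebra (space M) X borel"
  have sets_G: "sets G = {X -` A \<inter> space M |A. A \<in> sets borel}"
    unfolding G_def by (rule sets_vimage_algebra2) simp
  have "subalgebra M G"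
    using X by (auto simp: subalgebra_def sets_G) (simp_all add: G_def)
  then interpret G: finite_measure_subalgebra M G by unfold_locales
  have XG: "X \<in> borel_measurable G"
    unfolding G_def by (rule measurable_vimage_algebra1) simp
  have "AE s in M. real_cond_exp M G W s = 0"
  proof (rule G.real_cond_exp_charact)
    fix C assume "C \<in> sets G"
    then obtain A where A: "A \<in> sets borel" "C = X -` A \<inter> space M" by (auto simp: sets_G)
    have "(\<integral>s\<in>C. W s \<partial>M) = (\<integral>s. W s * indicator A (X s) \<partial>M)"
      unfolding set_lebesgue_integral_def A(2)
      by (intro Bochner_Integration.integral_cong) (auto simp: indicator_def)
    then show "(\<integral>s\<in>C. W s \<partial>M) = (\<integral>s\<in>C. 0 \<partial>M)"
      using orth[OF A(1)] by (simp add: set_lebesgue_integral_def)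
  qed (use W in auto)
  then have "(\<integral>s. u (X s) * real_cond_exp M G W s \<partial>M) = (\<integral>s. 0 \<partial>M)"
    using X u measurable_from_subalg[OF G.subalg borel_measurable_cond_exp]
    by (intro integral_cong_AE) auto
  moreover have "(\<integral>s. u (X s) * real_cond_exp M G W s \<partial>M) = (\<integral>s. u (X s) * W s \<partial>M)"
    using int W XG u by (intro G.real_cond_exp_intg(2)) (auto simp: mult.commute)
  ultimately show ?thesis by (simp add: mult.commute)
qed

context finite_measure_subalgebra
begin

text \<open>
  The definition of conditional independence speaks about the product over all of \<open>I\<close>; the factors
  other than \<open>i\<close> and \<open>j\<close> are removed by choosing the whole space for them.
\<close>

lemma cond_indep_pair:
  assumes ci: "cond_indep_vars M F X I" and "finite I" "i \<in> I" "j \<in> I" "i \<noteq> j"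
    and A: "A \<in> sets borel" and B: "B \<in> sets borel"
  shows "AE s in M. real_cond_exp M F (\<lambda>t. indicator A (X i t) * indicator B (X j t)) s =
     real_cond_exp M F (\<lambda>t. indicator A (X i t)) s * real_cond_exp M F (\<lambda>t. indicator B (X j t)) s"
proof -
  define E where "E k = (if k = i then A else if k = j then B else UNIV)" for k
  have I: "I = insert i (insert j (I - {i, j}))" using assms by auto
  have 1: "(\<Prod>k\<in>I. h k) = h i * (h j * (\<Prod>k\<in>I - {i, j}. h k))" for h :: "_ \<Rightarrow> real"
    by (subst I) (use \<open>finite I\<close> \<open>i \<noteq> j\<close> in simp)
  have "AE s in M. real_cond_exp M F (\<lambda>t. \<Prod>k\<in>I. indicator (E k) (X k t)) s
     = (\<Prod>k\<in>I. real_cond_exp M F (\<lambda>t. indicator (E k) (X k t)) s)"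
    using ci A B unfolding cond_indep_vars_def by (simp add: E_def)
  moreover have "AE s in M. real_cond_exp M F (\<lambda>t. 1) s = 1"
    by (rule real_cond_exp_F_meas) auto
  ultimately show ?thesis
    unfolding 1 by eventually_elim (use \<open>i \<noteq> j\<close> in \<open>simp add: E_def\<close>)
qed

text \<open>
  Conditional independence of events gives orthogonality of functions by using
  \<open>orthogonal_to_functions_of\<close> twice: first for functions of \<open>X i\<close> with the event
  \<open>X j \<in> B\<close> kept fixed, then for functions of \<open>X j\<close>.
\<close>

lemma cond_indep_orthogonal_real:
  fixes X :: "'i \<Rightarrow> 'a \<Rightarrow> 'c::euclidean_space"
  assumes ci: "cond_indep_vars M F X I" and I: "finite I" "i \<in> I" "j \<in> I" "i \<noteq> j"
    and u: "u \<in> borel_measurable borel" "sq_int M (\<lambda>s. u (X i s))"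
    and v: "v \<in> borel_measurable borel" "sq_int M (\<lambda>s. v (X j s))"
    and m: "m \<in> borel_measurable F" "sq_int M m"
    and mu: "AE s in M. real_cond_exp M F (\<lambda>t. u (X i t)) s = m s" and C: "C \<in> sets F"
  shows "(\<integral>s. indicator C s * (u (X i s) - m s) * v (X j s) \<partial>M) = 0"
proof -
  note CM = subalgebra_sets[OF subalg C]
  have X: "X i \<in> borel_measurable M" "X j \<in> borel_measurable M"
    using ci I by (auto simp: cond_indep_vars_def)
  note [measurable] = X m(1) u(1) v(1) C CM
  have [measurable]: "m \<in> borel_measurable M" by (rule measurable_from_subalg[OF subalg m(1)])
  have iu: "integrable M (\<lambda>s. u (X i s))" and im: "integrable M m" using sq_int_integrable u m by auto
  define W where "W s = indicator C s * (u (X i s) - m s)" for s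
  have W: "sq_int M W" unfolding W_def using u m sq_int_indicator[OF sq_int_diff CM, of "\<lambda>s. u (X i s)" m]
    by simp
  have bd: "integrable M (\<lambda>s. c s * h s)"
    if "integrable M h" "c \<in> borel_measurable M" "AE s in M. \<bar>c s\<bar> \<le> 1" for c h :: "_ \<Rightarrow> real"
    using that(1)
    by (rule Bochner_Integration.integrable_bound)
      (use that in \<open>auto simp: abs_mult intro: mult_left_le_one_le elim!: eventually_mono\<close>)
  have "(\<integral>s. W s * indicator B (X j s) \<partial>M) = 0" if B[measurable]: "B \<in> sets borel" for B
  proof -
    define p where "p = real_cond_exp M F (\<lambda>t. indicator B (X j t))"
    have pF[measurable]: "p \<in> borel_measurable F" and pM[measurable]: "p \<in> borel_measurable M"
      unfolding p_def by auto
    have iB: "integrable M (\<lambda>t. indicator B (X j t) :: real)"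
      by (intro integrable_const_bound[of _ 1]) (auto simp: indicator_def)
    have p: "AE s in M. 0 \<le> p s" "AE s in M. p s \<le> 1"
      unfolding p_def by (intro real_cond_exp_ge_c real_cond_exp_le_c iB; simp add: indicator_def)+
    have p': "AE s in M. \<bar>p s\<bar> \<le> 1" using p by eventually_elim auto
    have ip: "integrable M p" unfolding p_def by (rule real_cond_exp_int(1)[OF iB])
    have c1: "AE s in M. \<bar>indicator C s * indicator B (X j s) :: real\<bar> \<le> 1"
      by (auto simp: indicator_def)
    have c2: "AE s in M. \<bar>indicator C s * p s\<bar> \<le> 1"
      using p' by eventually_elim (auto simp: indicator_def)
    \<comment> \<open>Conditional independence says that \<open>V\<close> is orthogonal to all events \<open>X i \<in> A\<close>.\<close>
    define V where "V s = indicator C s * (indicator B (X j s) - p s)" for s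
    have iV: "integrable M V"
      unfolding V_def using bd[of "\<lambda>s. indicator B (X j s) - p s" "indicator C"] iB ip
      by (simp add: indicator_def)
    have c3: "AE s in M. \<bar>V s\<bar> \<le> 1" 
      using p unfolding V_def by eventually_elim (auto simp: indicator_def)
    have "(\<integral>s. V s * u (X i s) \<partial>M) = 0"
    proof (rule orthogonal_to_functions_of[OF iV X(1) u(1)])
      show "integrable M (\<lambda>s. V s * u (X i s))"
        by (rule bd[OF iu _ c3]) (use iV in auto)
      fix A assume A[measurable]: "A \<in> sets (borel :: 'c measure)"
      define q where "q = real_cond_exp M F (\<lambda>t. indicator A (X i t))"
      have iA: "integrable M (\<lambda>t. indicator A (X i t) :: real)"
        by (intro integrable_const_bound[of _ 1]) (auto simp: indicator_def)
      have iAB: "integrable M (\<lambda>t. indicator A (X i t) * indicator B (X j t) :: real)"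
        by (intro integrable_const_bound[of _ 1]) (auto simp: indicator_def)
      have qF[measurable]: "q \<in> borel_measurable F" "q \<in> borel_measurable M" unfolding q_def by auto
      have "(\<integral>s. V s * indicator A (X i s) \<partial>M) =
          (\<integral>s. indicator C s * (indicator A (X i s) * indicator B (X j s)) \<partial>M)
          - (\<integral>s. (indicator C s * p s) * indicator A (X i s) \<partial>M)"
        using bd[OF iAB, of "indicator C"] bd[OF iA _ c2]
        by (subst Bochner_Integration.integral_diff[symmetric])
          (auto simp: V_def algebra_simps indicator_def intro!: Bochner_Integration.integral_cong)
      also have "(\<integral>s. indicator C s * (indicator A (X i s) * indicator B (X j s)) \<partial>M) =
          (\<integral>s. indicator C s * real_cond_exp M F (\<lambda>t. indicator A (X i t) * indicator B (X j t)) s \<partial>M)"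
        using bd[OF iAB, of "indicator C"]
        by (intro real_cond_exp_intg(2)[symmetric]) (auto simp: indicator_def)
      also have "\<dots> = (\<integral>s. (indicator C s * p s) * q s \<partial>M)"
        using cond_indep_pair[OF ci I A B]
        by (intro integral_cong_AE) (auto simp: p_def q_def)
      also have "(\<integral>s. (indicator C s * p s) * indicator A (X i s) \<partial>M) = (\<integral>s. (indicator C s * p s) * q s \<partial>M)"
        unfolding q_def using bd[OF iA _ c2] by (intro real_cond_exp_intg(2)[symmetric]) auto
      finally show "(\<integral>s. V s * indicator A (X i s) \<partial>M) = 0" by simp
    qed
    then have "0 = (\<integral>s. (indicator C s * indicator B (X j s)) * u (X i s) \<partial>M)
        - (\<integral>s. (indicator C s * p s) * u (X i s) \<partial>M)"
      using bd[OF iu _ c1] bd[OF iu _ c2]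
      by (subst Bochner_Integration.integral_diff[symmetric]) (auto simp: V_def algebra_simps)
    also have "(\<integral>s. (indicator C s * p s) * u (X i s) \<partial>M) =
        (\<integral>s. (indicator C s * p s) * real_cond_exp M F (\<lambda>t. u (X i t)) s \<partial>M)"
      using bd[OF iu _ c2] by (intro real_cond_exp_intg(2)[symmetric]) auto
    also have "\<dots> = (\<integral>s. (indicator C s * m s) * p s \<partial>M)"
      using mu by (intro integral_cong_AE) auto
    also have "\<dots> = (\<integral>s. (indicator C s * m s) * indicator B (X j s) \<partial>M)"
      unfolding p_def using bd[OF im _ c1] 
      by (intro real_cond_exp_intg(2)) (auto simp: mult_ac)
    also have "(\<integral>s. (indicator C s * indicator B (X j s)) * u (X i s) \<partial>M) - \<dots> =
        (\<integral>s. W s * indicator B (X j s) \<partial>M)"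
      using bd[OF iu _ c1] bd[OF im _ c1]
      by (subst Bochner_Integration.integral_diff[symmetric]) (auto simp: W_def algebra_simps)
    finally show ?thesis by simp
  qed
  then have "(\<integral>s. W s * v (X j s) \<partial>M) = 0"
    using W v by (intro orthogonal_to_functions_of[OF sq_int_integrable[OF W] X(2) v(1)] integrable_mult_sq_int) auto
  then show ?thesis by (simp add: W_def)
qed

text \<open>
  Only the vector \<open>X i\<close> has to be centred by its conditional mean: the term with \<open>mj\<close>
  vanishes because \<open>mj\<close> belongs to the past.
\<close>

lemma cond_indep_orthogonal:
  assumes ci: "cond_indep_vars M F X I" and I: "finite I" "i \<in> I" "j \<in> I" "i \<noteq> j"
    and sq: "sq_int M (X i)" "sq_int M (X j)" "sq_int M mi" "sq_int M mj"
    and m: "mi \<in> borel_measurable F" "mj \<in> borel_measurable F"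
    and ce: "has_cond_exp M F (X i) mi" and C: "C \<in> sets F"
  shows "(\<integral>s. (indicator C s *\<^sub>R (X i s - mi s)) \<bullet> (X j s - mj s) \<partial>M) = 0"
proof -
  note CM = subalgebra_sets[OF subalg C]
  let ?U = "\<lambda>s. indicator C s *\<^sub>R (X i s - mi s)"
  have U: "sq_int M ?U" using sq CM by (intro sq_int_indicator sq_int_diff)
  have 1: "(\<integral>s. (?U s \<bullet> b) * (X j s \<bullet> b) \<partial>M) = 0" if b: "b \<in> Basis" for b
  proof -
    have "(\<integral>s. indicator C s * (X i s \<bullet> b - mi s \<bullet> b) * (X j s \<bullet> b) \<partial>M) = 0"
      using has_cond_expD_component[OF ce b] sq b m
      by (intro cond_indep_orthogonal_real[OF ci I, of "\<lambda>x. x \<bullet> b" "\<lambda>x. x \<bullet> b" "\<lambda>s. mi s \<bullet> b"]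
          sq_int_component C borel_measurable_inner) auto
    then show ?thesis by (simp add: inner_diff_left)
  qed
  have "(\<integral>s. ?U s \<bullet> X j s \<partial>M) = (\<integral>s. (\<Sum>b\<in>Basis. (?U s \<bullet> b) * (X j s \<bullet> b)) \<partial>M)"
    by (intro Bochner_Integration.integral_cong refl euclidean_inner)
  also have "\<dots> = (\<Sum>b\<in>Basis. \<integral>s. (?U s \<bullet> b) * (X j s \<bullet> b) \<partial>M)"
    by (intro Bochner_Integration.integral_sum integrable_mult_sq_int sq_int_component U sq) auto
  finally have UX: "(\<integral>s. ?U s \<bullet> X j s \<partial>M) = 0" using 1 by simp
  let ?Z = "\<lambda>s. indicator C s *\<^sub>R mj s"
  have Z: "sq_int M ?Z" "?Z \<in> borel_measurable F"
    using sq CM C m by (auto intro!: sq_int_indicator borel_measurable_scaleR)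
  have "(\<integral>s. ?U s \<bullet> mj s \<partial>M) = (\<integral>s. ?Z s \<bullet> X i s - ?Z s \<bullet> mi s \<partial>M)"
    by (intro Bochner_Integration.integral_cong) (auto simp: inner_diff_left inner_commute algebra_simps)
  also have "\<dots> = 0"
    using has_cond_expD[OF ce sq(1,3) Z] Z sq by (simp add: integrable_inner del: inner_scaleR_left)
  finally have "(\<integral>s. ?U s \<bullet> mj s \<partial>M) = 0" .
  moreover have "(\<integral>s. ?U s \<bullet> (X j s - mj s) \<partial>M) = (\<integral>s. ?U s \<bullet> X j s \<partial>M) - (\<integral>s. ?U s \<bullet> mj s \<partial>M)"
    using U sq by (simp add: inner_diff_right integrable_inner del: inner_scaleR_left)
  ultimately show ?thesis using UX by simp
qed

end

section \<open>Quantization with an independent seed\<close>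

text \<open>
  The \<open>\<sigma>\<close>-algebra \<open>G\<close> collects all randomness other than the seed.
\<close>

locale fresh_seed = prob_space M for M :: "'w measure" +
  fixes G :: "'w measure" and N :: "'z measure" and \<zeta> :: "'w \<Rightarrow> 'z"
  assumes sub: "subalgebra M G"
    and seed: "\<zeta> \<in> measurable M N" "distr M N \<zeta> = N"
    and indep: "indep_set (sets G) (sets (vimage_algebra (space M) \<zeta> N))"
begin

lemma id_measurable: "(\<lambda>s. s) \<in> measurable M G"
  using sub by (auto simp: measurable_def subalgebra_def sets.Int_space_eq2)

text \<open>
  Independence of \<open>\<zeta>\<close> from \<open>G\<close>, expressed as independence of \<open>\<zeta>\<close> from the identity map into
  the measurable space \<open>G\<close>. With this choice every \<open>G\<close>-measurable function is a function of the
  first component, and Fubini's theorem freezes all of them at once.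
\<close>

lemma joint_law: "distr M G (\<lambda>s. s) \<Otimes>\<^sub>M N = distr M (G \<Otimes>\<^sub>M N) (\<lambda>s. (s, \<zeta> s))"
proof (rule pair_measure_eqI)
  interpret N: prob_space N using prob_space_distr[OF seed(1)] seed(2) by simp
  interpret G: prob_space "distr M G (\<lambda>s. s)" using id_measurable by (rule prob_space_distr)
  show "sigma_finite_measure (distr M G (\<lambda>s. s))" "sigma_finite_measure N" ..
  show "sets (distr M G (\<lambda>s. s) \<Otimes>\<^sub>M N) = sets (distr M (G \<Otimes>\<^sub>M N) (\<lambda>s. (s, \<zeta> s)))"
    by (simp cong: sets_pair_measure_cong)
  fix A B assume "A \<in> sets (distr M G (\<lambda>s. s))" and B: "B \<in> sets N"
  then have A: "A \<in> sets G" by simp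
  then have AM: "A \<in> sets M" "A \<subseteq> space M" using sub sets.sets_into_space[OF A]
    by (auto simp: subalgebra_def)
  have \<zeta>B: "\<zeta> -` B \<inter> space M \<in> sets (vimage_algebra (space M) \<zeta> N)"
    by (rule in_vimage_algebra[OF B])
  have "emeasure N B = emeasure (distr M N \<zeta>) B" using seed(2) by simp
  also have "\<dots> = prob (\<zeta> -` B \<inter> space M)"
    using seed(1) B by (simp add: emeasure_distr emeasure_eq_measure)
  finally have NB: "emeasure N B = prob (\<zeta> -` B \<inter> space M)" .
  have GA: "emeasure (distr M G (\<lambda>s. s)) A = prob A"
    using id_measurable A AM by (simp add: emeasure_distr emeasure_eq_measure Int_absorb2)
  have "(\<lambda>s. (s, \<zeta> s)) -` (A \<times> B) \<inter> space M = A \<inter> (\<zeta> -` B \<inter> space M)"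
    using AM by auto
  then have "emeasure (distr M (G \<Otimes>\<^sub>M N) (\<lambda>s. (s, \<zeta> s))) (A \<times> B) = prob (A \<inter> (\<zeta> -` B \<inter> space M))"
    using id_measurable seed(1) A B by (simp add: emeasure_distr emeasure_eq_measure)
  then show "emeasure (distr M G (\<lambda>s. s)) A * emeasure N B =
      emeasure (distr M (G \<Otimes>\<^sub>M N) (\<lambda>s. (s, \<zeta> s))) (A \<times> B)"
    by (simp add: NB GA indep_setD[OF indep A \<zeta>B] ennreal_mult')
qed

lemma nn_integral_freeze:
  assumes H: "H \<in> borel_measurable (G \<Otimes>\<^sub>M N)"
  shows "(\<integral>\<^sup>+s. H (s, \<zeta> s) \<partial>M) = (\<integral>\<^sup>+s. \<integral>\<^sup>+z. H (s, z) \<partial>N \<partial>M)"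
proof -
  interpret N: prob_space N using prob_space_distr[OF seed(1)] seed(2) by simp
  have "(\<integral>\<^sup>+s. H (s, \<zeta> s) \<partial>M) = integral\<^sup>N (distr M G (\<lambda>s. s) \<Otimes>\<^sub>M N) H"
    unfolding joint_law using H seed id_measurable by (simp add: nn_integral_distr)
  also have "\<dots> = (\<integral>\<^sup>+s. \<integral>\<^sup>+z. H (s, z) \<partial>N \<partial>distr M G (\<lambda>s. s))"
    using H by (intro N.nn_integral_fst[symmetric]) simp
  also have "\<dots> = (\<integral>\<^sup>+s. \<integral>\<^sup>+z. H (s, z) \<partial>N \<partial>M)"
    using H N.borel_measurable_nn_integral_fst[OF H] id_measurable by (simp add: nn_integral_distr)
  finally show ?thesis .
qed

lemma integral_freeze:
  fixes H :: "'w \<times> 'z \<Rightarrow> real"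
  assumes H: "H \<in> borel_measurable (G \<Otimes>\<^sub>M N)" and int: "integrable M (\<lambda>s. H (s, \<zeta> s))"
  shows "(\<integral>s. H (s, \<zeta> s) \<partial>M) = (\<integral>s. \<integral>z. H (s, z) \<partial>N \<partial>M)"
proof -
  interpret N: prob_space N using prob_space_distr[OF seed(1)] seed(2) by simp
  interpret G: prob_space "distr M G (\<lambda>s. s)" using id_measurable by (rule prob_space_distr)
  interpret pair_sigma_finite "distr M G (\<lambda>s. s)" N ..
  have m: "(\<lambda>s. (s, \<zeta> s)) \<in> measurable M (G \<Otimes>\<^sub>M N)" using seed id_measurable by simp
  have "integrable (distr M G (\<lambda>s. s) \<Otimes>\<^sub>M N) H"
    unfolding joint_law using H int m by (simp add: integrable_distr_eq)
  then have "integral\<^sup>L (distr M G (\<lambda>s. s) \<Otimes>\<^sub>M N) H = (\<integral>s. \<integral>z. H (s, z) \<partial>N \<partial>distr M G (\<lambda>s. s))"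
    by (rule integral_fst'[symmetric])
  also have "\<dots> = (\<integral>s. \<integral>z. H (s, z) \<partial>N \<partial>M)"
    using H id_measurable
    by (intro integral_distr N.borel_measurable_lebesgue_integral) simp_all
  finally show ?thesis
    unfolding joint_law using H m by (simp add: integral_distr)
qed

end

locale quantization_noise = fresh_seed M G N \<zeta>
  for M :: "'w measure" and G :: "'w measure" and N :: "'z measure" and \<zeta> +
  fixes Q :: "'a::euclidean_space \<Rightarrow> 'z \<Rightarrow> 'a" and \<omega> :: real and h :: "'w \<Rightarrow> 'a"
  assumes quant: "quantizer N Q \<omega>" and \<omega>: "\<omega> > 0"
    and h: "h \<in> borel_measurable G" "sq_int M h"
begin

definition noise :: "'w \<Rightarrow> 'a" where
  "noise s = Q (h s) (\<zeta> s) - h s"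

lemma Q_measurable: "(\<lambda>(x, z). Q x z) \<in> borel_measurable (borel \<Otimes>\<^sub>M N)"
  using quant by (simp add: quantizer_def)

lemma joint_measurable: "(\<lambda>p. Q (h (fst p)) (snd p) - h (fst p)) \<in> borel_measurable (G \<Otimes>\<^sub>M N)"
proof -
  have "(\<lambda>p. (\<lambda>(x, z). Q x z) (h (fst p), snd p)) \<in> borel_measurable (G \<Otimes>\<^sub>M N)"
    by (rule measurable_compose[OF _ Q_measurable]) (use h in measurable)
  then show ?thesis using h(1) by simp
qed

lemma noise_measurable: "noise \<in> borel_measurable M"
proof -
  have "(\<lambda>s. (s, \<zeta> s)) \<in> measurable M (G \<Otimes>\<^sub>M N)" using seed id_measurable by simp
  from measurable_compose[OF this joint_measurable] show ?thesis by (simp add: noise_def[abs_def])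
qed

text \<open>
  Stated for nonnegative integrals, since it is also the proof that the noise is
  square integrable.
\<close>

lemma noise_nn_bound:
  assumes C: "C \<in> sets G"
  shows "(\<integral>\<^sup>+s. ennreal (indicator C s * (norm (noise s))\<^sup>2) \<partial>M)
     \<le> (\<integral>\<^sup>+s. ennreal (indicator C s * (\<omega> * (norm (h s))\<^sup>2)) \<partial>M)"
proof -
  define H where "H p = ennreal (indicator C (fst p) * (norm (Q (h (fst p)) (snd p) - h (fst p)))\<^sup>2)" for p
  have H: "H \<in> borel_measurable (G \<Otimes>\<^sub>M N)"
    unfolding H_def using C joint_measurable by measurable
  have "(\<integral>\<^sup>+s. ennreal (indicator C s * (norm (noise s))\<^sup>2) \<partial>M) = (\<integral>\<^sup>+s. H (s, \<zeta> s) \<partial>M)"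
    by (simp add: H_def noise_def)
  also have "\<dots> = (\<integral>\<^sup>+s. \<integral>\<^sup>+z. H (s, z) \<partial>N \<partial>M)" by (rule nn_integral_freeze[OF H])
  also have "\<dots> \<le> (\<integral>\<^sup>+s. ennreal (indicator C s * (\<omega> * (norm (h s))\<^sup>2)) \<partial>M)"
  proof (rule nn_integral_mono)
    fix s
    have "(\<integral>\<^sup>+z. H (s, z) \<partial>N) = ennreal (\<integral>z. indicator C s * (norm (Q (h s) z - h s))\<^sup>2 \<partial>N)"
      unfolding H_def using quant by (subst nn_integral_eq_integral) (auto simp: quantizer_def)
    also have "\<dots> \<le> ennreal (indicator C s * (\<omega> * (norm (h s))\<^sup>2))"
      using quant by (intro ennreal_leI) (auto simp: quantizer_def indicator_def)
    finally show "(\<integral>\<^sup>+z. H (s, z) \<partial>N) \<le> ennreal (indicator C s * (\<omega> * (norm (h s))\<^sup>2))" .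
  qed
  finally show ?thesis .
qed

lemma sq_int_noise: "sq_int M noise"
proof -
  have "(\<integral>\<^sup>+s. ennreal ((norm (noise s))\<^sup>2) \<partial>M) = (\<integral>\<^sup>+s. ennreal (indicator (space G) s * (norm (noise s))\<^sup>2) \<partial>M)"
    using sub by (intro nn_integral_cong) (simp add: subalgebra_def)
  also have "\<dots> \<le> (\<integral>\<^sup>+s. ennreal (indicator (space G) s * (\<omega> * (norm (h s))\<^sup>2)) \<partial>M)"
    by (rule noise_nn_bound) auto
  also have "\<dots> \<le> (\<integral>\<^sup>+s. ennreal (\<omega> * (norm (h s))\<^sup>2) \<partial>M)"
    using \<omega> by (intro nn_integral_mono ennreal_leI) (auto simp: indicator_def)
  also have "\<dots> < \<infinity>"
    using \<omega> h by (subst nn_integral_eq_integral) (auto simp: sq_int_def)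
  finally have "integrable M (\<lambda>s. (norm (noise s))\<^sup>2)"
    using noise_measurable by (intro integrableI_bounded) auto
  then show ?thesis using noise_measurable by (simp add: sq_int_def)
qed

lemma noise_bound:
  assumes C: "C \<in> sets G"
  shows "(\<integral>s. indicator C s * (norm (noise s))\<^sup>2 \<partial>M) \<le> \<omega> * (\<integral>s. indicator C s * (norm (h s))\<^sup>2 \<partial>M)"
proof -
  note CM = subalgebra_sets[OF sub C]
  have "integrable M (\<lambda>s. indicator C s * (norm (noise s))\<^sup>2)"
    and ih: "integrable M (\<lambda>s. indicator C s * (norm (h s))\<^sup>2)"
    using integrable_mult_indicator[OF CM, of "\<lambda>s. (norm (noise s))\<^sup>2"]
      integrable_mult_indicator[OF CM, of "\<lambda>s. (norm (h s))\<^sup>2"] sq_int_noise h by (auto simp: sq_int_def)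
  moreover from ih have "integrable M (\<lambda>s. indicator C s * (\<omega> * (norm (h s))\<^sup>2))"
    by (simp add: mult.left_commute)
  ultimately have "(\<integral>s. indicator C s * (norm (noise s))\<^sup>2 \<partial>M) \<le> (\<integral>s. indicator C s * (\<omega> * (norm (h s))\<^sup>2) \<partial>M)"
    using noise_nn_bound[OF C] \<omega>
    by (simp add: nn_integral_eq_integral Bochner_Integration.integral_nonneg)
  also have "\<dots> = \<omega> * (\<integral>s. indicator C s * (norm (h s))\<^sup>2 \<partial>M)"
    by (simp add: mult.left_commute)
  finally show ?thesis .
qed

text \<open>
  With \<open>G\<close> frozen, the inner integral over the seed vanishes because \<open>Q\<close> is unbiased.
\<close>

lemma noise_orthogonal:
  assumes Y: "Y \<in> borel_measurable G" "sq_int M Y"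
  shows "(\<integral>s. Y s \<bullet> noise s \<partial>M) = 0"
proof -
  define H where "H p = Y (fst p) \<bullet> (Q (h (fst p)) (snd p) - h (fst p))" for p
  have H: "H \<in> borel_measurable (G \<Otimes>\<^sub>M N)"
    unfolding H_def using Y joint_measurable by measurable
  have "(\<integral>s. Y s \<bullet> noise s \<partial>M) = (\<integral>s. H (s, \<zeta> s) \<partial>M)"
    by (simp add: H_def noise_def)
  also have "\<dots> = (\<integral>s. \<integral>z. H (s, z) \<partial>N \<partial>M)"
    using integrable_inner[OF Y(2) sq_int_noise] by (intro integral_freeze H) (simp add: H_def noise_def)
  also have "\<dots> = (\<integral>s. 0 \<partial>M)"
  proof (rule Bochner_Integration.integral_cong)
    fix s
    have N: "prob_space N" and Qi: "integrable N (Q (h s))" "(\<integral>z. Q (h s) z \<partial>N) = h s"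
      using quant by (auto simp: quantizer_def)
    interpret N: prob_space N by (rule N)
    show "(\<integral>z. H (s, z) \<partial>N) = 0"
      using Qi by (simp add: H_def N.prob_space)
  qed simp
  finally show ?thesis by simp
qed

end

section \<open>Geometric weights\<close>

lemma weight_eq: "weight \<eta> k = 1 / (1 - \<eta>) ^ Suc k"
proof -
  have "- (int k + 1) = - int (Suc k)" by simp
  then have "weight \<eta> k = (1 - \<eta>) powi (- int (Suc k))" by (simp only: weight_def)
  then show ?thesis unfolding power_int_minus power_int_of_nat by (simp add: inverse_eq_divide)
qed

lemma weight_pos: "\<eta> < 1 \<Longrightarrow> weight \<eta> k > 0"
  by (simp add: weight_eq)

lemma weight_Suc: "\<eta> < 1 \<Longrightarrow> weight \<eta> (Suc k) * (1 - \<eta>) = weight \<eta> k"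
  by (simp add: weight_eq)

lemma weight_sum_pos: "\<eta> < 1 \<Longrightarrow> weight_sum \<eta> K > 0"
  unfolding weight_sum_def by (intro sum_pos weight_pos) auto

text \<open>
  Bernoulli's inequality gives \<open>(1 - \<eta>) ^ \<tau> \<ge> 1 - \<tau> \<eta> \<ge> 1 / 2\<close>.
\<close>

lemma weight_delay:
  assumes "0 \<le> \<eta>" "\<eta> < 1" "real \<tau> * \<eta> \<le> 1 / 2" "t \<le> k" "k \<le> t + \<tau>"
  shows "weight \<eta> k \<le> 2 * weight \<eta> t"
proof -
  obtain j where j: "k = t + j" "j \<le> \<tau>" using assms(4,5) by (metis le_Suc_ex nat_add_left_cancel_le)
  have "1 / 2 \<le> 1 - real \<tau> * \<eta>" using assms(3) by simp
  also have "\<dots> \<le> (1 - \<eta>) ^ \<tau>"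
    using Bernoulli_inequality[of "- \<eta>" \<tau>] assms(1,2) by simp
  also have "\<dots> \<le> (1 - \<eta>) ^ j" using j assms by (intro power_decreasing) auto
  finally have "1 / (1 - \<eta>) ^ j \<le> 2" using assms(2) by (simp add: divide_simps)
  then have "weight \<eta> t * (1 / (1 - \<eta>) ^ j) \<le> weight \<eta> t * 2"
    using weight_pos[OF assms(2), of t] by (intro mult_left_mono) auto
  moreover have "weight \<eta> k = weight \<eta> t * (1 / (1 - \<eta>) ^ j)"
    by (simp add: weight_eq j power_add)
  ultimately show ?thesis by simp
qed

text \<open>
  Each index \<open>t\<close> lies in the windows of at most \<open>\<tau>\<close> steps \<open>k\<close>, and there \<open>weight \<eta> k\<close> is at
  most twice \<open>weight \<eta> t\<close>.
\<close>

lemma weighted_window_sum: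
  assumes \<eta>: "0 \<le> \<eta>" "\<eta> < 1" "real \<tau> * \<eta> \<le> 1 / 2" and \<delta>: "\<And>k. \<delta> k \<ge> 0"
  shows "(\<Sum>k=0..K. weight \<eta> k * (\<Sum>t\<in>{k - \<tau>..<k}. \<delta> t)) \<le> 2 * real \<tau> * (\<Sum>k=0..K. weight \<eta> k * \<delta> k)"
proof -
  define h where "h t = 2 * (weight \<eta> t * \<delta> t)" for t
  have h: "h t \<ge> 0" for t using weight_pos[OF \<eta>(2), of t] \<delta>[of t] by (simp add: h_def)
  have "(\<Sum>k=0..K. weight \<eta> k * (\<Sum>t\<in>{k - \<tau>..<k}. \<delta> t)) \<le> (\<Sum>k=0..K. \<Sum>t\<in>{k - \<tau>..<k}. h t)"
    unfolding sum_distrib_left h_def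
    by (intro sum_mono) (use weight_delay[OF \<eta>] \<delta> in \<open>auto simp flip: mult.assoc intro!: mult_right_mono\<close>)
  also have "\<dots> = (\<Sum>k=0..K. \<Sum>t=0..K. if t \<in> {k - \<tau>..<k} then h t else 0)"
  proof (rule sum.cong[OF refl])
    fix k assume "k \<in> {0..K}"
    then have "{0..K} \<inter> {k - \<tau>..<k} = {k - \<tau>..<k}" by auto
    then show "(\<Sum>t\<in>{k - \<tau>..<k}. h t) = (\<Sum>t=0..K. if t \<in> {k - \<tau>..<k} then h t else 0)"
      using sum.inter_restrict[of "{0..K}" h "{k - \<tau>..<k}"] by simp
  qed
  also have "\<dots> = (\<Sum>t=0..K. \<Sum>k=0..K. if t \<in> {k - \<tau>..<k} then h t else 0)"
    by (rule sum.swap)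
  also have "\<dots> \<le> (\<Sum>t=0..K. real \<tau> * h t)"
  proof (rule sum_mono)
    fix t
    have "(\<Sum>k=0..K. if t \<in> {k - \<tau>..<k} then h t else 0) = real (card {k \<in> {0..K}. t \<in> {k - \<tau>..<k}}) * h t"
      by (subst sum.inter_filter[symmetric]) simp_all
    also have "card {k \<in> {0..K}. t \<in> {k - \<tau>..<k}} \<le> card {t<..t + \<tau>}"
      by (intro card_mono) auto
    then have "real (card {k \<in> {0..K}. t \<in> {k - \<tau>..<k}}) * h t \<le> real \<tau> * h t"
      using h by (intro mult_right_mono) auto
    finally show "(\<Sum>k=0..K. if t \<in> {k - \<tau>..<k} then h t else 0) \<le> real \<tau> * h t" .
  qed
  also have "\<dots> = 2 * real \<tau> * (\<Sum>k=0..K. weight \<eta> k * \<delta> k)"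
    by (simp add: h_def sum_distrib_left mult_ac)
  finally show ?thesis .
qed

text \<open>
  Multiplying the recursion by \<open>weight \<eta> k\<close> makes it telescope, since
  \<open>weight \<eta> (Suc k) * (1 - \<eta>) = weight \<eta> k\<close>. Each step gains half of the gap, and the error
  hypothesis takes back a quarter of the weighted gaps.
\<close>

lemma weighted_recursion:
  assumes \<eta>: "\<eta> < 1" and "\<gamma> > 0" and r: "\<And>k. r k \<ge> 0"
    and step: "\<And>k. r (Suc k) \<le> (1 - \<eta>) * r k - \<gamma> / 2 * \<delta> k + 3 * L * \<gamma> * E k + \<gamma>\<^sup>2 * D1"
    and error: "3 * L * (\<Sum>k=0..K. weight \<eta> k * E k) \<le> 1 / 4 * (\<Sum>k=0..K. weight \<eta> k * \<delta> k) + \<gamma> * D3 * weight_sum \<eta> K"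
  shows "(\<Sum>k=0..K. weight \<eta> k * \<delta> k) \<le> 4 * r 0 / \<gamma> + 4 * \<gamma> * (D1 + D3) * weight_sum \<eta> K"
proof -
  have stepw: "weight \<eta> k * r (Suc k) \<le> weight \<eta> k * (1 - \<eta>) * r k - \<gamma> / 2 * (weight \<eta> k * \<delta> k)
      + 3 * L * \<gamma> * (weight \<eta> k * E k) + \<gamma>\<^sup>2 * D1 * weight \<eta> k" for k
    using mult_left_mono[OF step[of k], of "weight \<eta> k"] weight_pos[OF \<eta>, of k] by (simp add: algebra_simps)
  have "weight \<eta> K * r (Suc K) + \<gamma> / 2 * (\<Sum>k=0..K. weight \<eta> k * \<delta> k)
      \<le> r 0 + 3 * L * \<gamma> * (\<Sum>k=0..K. weight \<eta> k * E k) + \<gamma>\<^sup>2 * D1 * weight_sum \<eta> K"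
  proof (induction K)
    case 0
    have "weight \<eta> 0 * (1 - \<eta>) = 1" using \<eta> by (simp add: weight_eq)
    then show ?case using stepw[of 0] by (simp add: weight_sum_def)
  next
    case (Suc K)
    have "weight_sum \<eta> (Suc K) = weight_sum \<eta> K + weight \<eta> (Suc K)" by (simp add: weight_sum_def)
    moreover have "weight \<eta> (Suc K) * r (Suc (Suc K)) \<le> weight \<eta> K * r (Suc K)
        - \<gamma> / 2 * (weight \<eta> (Suc K) * \<delta> (Suc K))
        + 3 * L * \<gamma> * (weight \<eta> (Suc K) * E (Suc K)) + \<gamma>\<^sup>2 * D1 * weight \<eta> (Suc K)"
      using stepw[of "Suc K"] by (simp only: weight_Suc[OF \<eta>])
    moreover have "(\<Sum>k=0..Suc K. h k) = (\<Sum>k=0..K. h k) + h (Suc K)" for h :: "nat \<Rightarrow> real"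
      by simp
    ultimately show ?case using Suc by (simp add: distrib_left)
  qed
  moreover have "\<gamma> * (3 * L * (\<Sum>k=0..K. weight \<eta> k * E k))
      \<le> \<gamma> * (1 / 4 * (\<Sum>k=0..K. weight \<eta> k * \<delta> k) + \<gamma> * D3 * weight_sum \<eta> K)"
    using error \<open>\<gamma> > 0\<close> by (intro mult_left_mono) auto
  moreover have "0 \<le> weight \<eta> K * r (Suc K)" using weight_pos[OF \<eta>, of K] r by simp
  ultimately have "\<gamma> * (\<Sum>k=0..K. weight \<eta> k * \<delta> k) \<le> 4 * r 0 + 4 * \<gamma>\<^sup>2 * (D1 + D3) * weight_sum \<eta> K"
    by (simp add: algebra_simps power2_eq_square)
  also have "\<dots> = \<gamma> * (4 * r 0 / \<gamma> + 4 * \<gamma> * (D1 + D3) * weight_sum \<eta> K)"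
    using \<open>\<gamma> > 0\<close> by (simp add: distrib_left power2_eq_square)
  finally show ?thesis using \<open>\<gamma> > 0\<close> by simp
qed

section \<open>Filtration and iterates of D-QSGD\<close>

lemma subalgebra_sigma:
  assumes "space A = \<Omega>" "U \<subseteq> sets A"
  shows "subalgebra A (sigma \<Omega> U)"
proof -
  have "U \<subseteq> Pow \<Omega>" using assms sets.space_closed[of A] by auto
  then show ?thesis
    using assms sets.sigma_sets_subset[of U A] by (simp add: subalgebra_def)
qed

lemma subalgebra_sets_vimage:
  "space A = \<Omega> \<Longrightarrow> f \<in> measurable A N \<Longrightarrow> sets (vimage_algebra \<Omega> f N) \<subseteq> sets A"
  by (rule sets_image_in_sets)

lemma measurable_if_vimage_subset:
  assumes "f \<in> space A \<rightarrow> space N" "sets (vimage_algebra (space A) f N) \<subseteq> sets A"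
  shows "f \<in> measurable A N"
  using assms in_vimage_algebra[of _ N f "space A"] by (auto simp: measurable_def)

lemma sets_vimage_Pow: "sets (vimage_algebra \<Omega> f N) \<subseteq> Pow \<Omega>"
  using sets.space_closed[of "vimage_algebra \<Omega> f N"] by simp

text \<open>
  The process without conditions on \<open>\<gamma>\<close> and \<open>\<tau>\<close>: the moment bounds hold for every step size, and
  they use that \<open>xs\<close> is a minimizer in place of quasi-strong convexity.
\<close>

locale dqsgd_process =
  fixes M :: "'w measure" and n :: nat and fs :: "nat \<Rightarrow> 'a::euclidean_space \<Rightarrow> real"
    and xs :: 'a and \<gamma> :: real and \<tau> :: nat and x0 :: 'a
    and N :: "'z measure" and Q :: "'a \<Rightarrow> 'z \<Rightarrow> 'a" and \<omega> :: real and Dw :: "nat \<Rightarrow> real"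
    and S :: "nat \<Rightarrow> 'x measure"
    and \<xi> :: "nat \<Rightarrow> nat \<Rightarrow> 'w \<Rightarrow> 'x" and \<zeta> :: "nat \<Rightarrow> nat \<Rightarrow> 'w \<Rightarrow> 'z"
    and gh g :: "nat \<Rightarrow> nat \<Rightarrow> 'w \<Rightarrow> 'a" and x :: "nat \<Rightarrow> 'w \<Rightarrow> 'a"
    and L :: real and f :: "'a \<Rightarrow> real"
  assumes n: "n \<ge> 1" and f_def: "f = (\<lambda>y. (1 / real n) * (\<Sum>i=1..n. fs i y))"
    and convex_fs: "\<And>i. i \<in> {1..n} \<Longrightarrow> convex_on UNIV (fs i)"
    and smooth_fs: "\<And>i. i \<in> {1..n} \<Longrightarrow> smooth_with L (fs i)"
    and L: "L > 0" and minimizer: "\<And>y. f xs \<le> f y"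
    and \<omega>: "\<omega> > 0" and quant: "quantizer N Q \<omega>"
    and Dw: "\<And>i. i \<in> {1..n} \<Longrightarrow> Dw i \<ge> 0"
    and run: "dqsgd M n fs xs \<gamma> \<tau> x0 N Q Dw S \<xi> \<zeta> gh g x"
begin

sublocale prob_space M
  using run by (simp add: dqsgd_def)

abbreviation history :: "nat \<Rightarrow> 'w measure" where
  "history \<equiv> past M n S N \<xi> \<zeta>"

abbreviation history_sample :: "nat \<Rightarrow> nat \<Rightarrow> 'w measure" where
  "history_sample \<equiv> past_and_sample M n S N \<xi> \<zeta>"

abbreviation others :: "nat \<Rightarrow> nat \<Rightarrow> 'w measure" where
  "others \<equiv> all_but_seed M n S N \<xi> \<zeta>"

lemma
  assumes "i \<in> {1..n}"
  shows sample_measurable: "\<xi> i k \<in> measurable M (S i)"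
    and gh_measurable: "gh i k \<in> borel_measurable (history_sample i k)"
    and gh_mean: "has_cond_exp M (history k) (gh i k) (\<lambda>s. grad (fs i) (x k s))"
    and gh_variance: "cond_exp_le M (history k)
          (\<lambda>s. (norm (gh i k s - grad (fs i) (x k s)))\<^sup>2) (\<lambda>s. Dw i)"
    and seed_measurable: "\<zeta> i k \<in> measurable M N"
    and seed_law: "distr M N (\<zeta> i k) = N"
    and seed_indep: "indep_set (sets (others i k)) (sets (vimage_algebra (space M) (\<zeta> i k) N))"
  using run assms by (auto simp: dqsgd_def fresh_seeds_def)

lemma gh_indep: "cond_indep_vars M (history k) (\<lambda>i. gh i k) {1..n}"
  using run by (simp add: dqsgd_def)

lemma space_history[simp]: "space (history k) = space M"
  and space_history_sample[simp]: "space (history_sample i k) = space M"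
  and space_others[simp]: "space (others i k) = space M"
  by (simp_all add: past_def past_and_sample_def all_but_seed_def space_measure_of_conv)

lemma sets_history: "i \<in> {1..n} \<Longrightarrow> t < k \<Longrightarrow> sets (vimage_algebra (space M) (\<xi> i t) (S i)) \<subseteq> sets (history k)"
  "i \<in> {1..n} \<Longrightarrow> t < k \<Longrightarrow> sets (vimage_algebra (space M) (\<zeta> i t) N) \<subseteq> sets (history k)"
proof -
  have "(\<Union>t\<in>{..<k}. \<Union>i\<in>{1..n}. sets (vimage_algebra (space M) (\<xi> i t) (S i))
                         \<union> sets (vimage_algebra (space M) (\<zeta> i t) N)) \<subseteq> sets (history k)"
    (is "?U \<subseteq> _")
  proof -
    have "?U \<subseteq> Pow (space M)"
      by (intro UN_least Un_least sets_vimage_Pow)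
    then show ?thesis unfolding past_def by (simp add: sigma_sets_superset_generator)
  qed
  then show "i \<in> {1..n} \<Longrightarrow> t < k \<Longrightarrow> sets (vimage_algebra (space M) (\<xi> i t) (S i)) \<subseteq> sets (history k)"
    "i \<in> {1..n} \<Longrightarrow> t < k \<Longrightarrow> sets (vimage_algebra (space M) (\<zeta> i t) N) \<subseteq> sets (history k)"
    by blast+
qed

lemma sets_others:
  "sets (history k) \<subseteq> sets (others i k)"
  "j \<in> {1..n} \<Longrightarrow> sets (vimage_algebra (space M) (\<xi> j k) (S j)) \<subseteq> sets (others i k)"
  "j \<in> {1..n} \<Longrightarrow> j \<noteq> i \<Longrightarrow> sets (vimage_algebra (space M) (\<zeta> j k) N) \<subseteq> sets (others i k)"
proof -
  let ?U = "sets (history k)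
      \<union> (\<Union>j\<in>{1..n}. sets (vimage_algebra (space M) (\<xi> j k) (S j)))
      \<union> (\<Union>j\<in>{1..n} - {i}. sets (vimage_algebra (space M) (\<zeta> j k) N))"
  have "?U \<subseteq> Pow (space M)"
    using sets.space_closed[of "history k"] by (intro Un_least UN_least sets_vimage_Pow) simp
  then have "?U \<subseteq> sets (others i k)"
    unfolding all_but_seed_def by (simp add: sigma_sets_superset_generator)
  then show "sets (history k) \<subseteq> sets (others i k)"
    "j \<in> {1..n} \<Longrightarrow> sets (vimage_algebra (space M) (\<xi> j k) (S j)) \<subseteq> sets (others i k)"
    "j \<in> {1..n} \<Longrightarrow> j \<noteq> i \<Longrightarrow> sets (vimage_algebra (space M) (\<zeta> j k) N) \<subseteq> sets (others i k)"
    by blast+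
qed

lemma subalgebra_history: "subalgebra M (history k)"
  unfolding past_def
  by (intro subalgebra_sigma refl UN_least Un_least subalgebra_sets_vimage sample_measurable seed_measurable)

lemma subalgebra_history_mono: "k \<le> k' \<Longrightarrow> subalgebra (history k') (history k)"
  unfolding past_def[of M n S N \<xi> \<zeta> k]
  by (intro subalgebra_sigma UN_least Un_least sets_history) auto

lemma subalgebra_others: "subalgebra M (others i k)"
  unfolding all_but_seed_def
  using subalgebra_history[of k, unfolded subalgebra_def]
  by (intro subalgebra_sigma refl UN_least Un_least subalgebra_sets_vimage sample_measurable seed_measurable)
    auto

lemma subalgebra_others_history: "subalgebra (others i k) (history k)"
  using sets_others(1) by (simp add: subalgebra_def)

lemma subalgebra_others_sample: "j \<in> {1..n} \<Longrightarrow> subalgebra (others i k) (history_sample j k)"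
  unfolding past_and_sample_def by (intro subalgebra_sigma Un_least sets_others) auto

lemma subalgebra_history_Suc: "i \<in> {1..n} \<Longrightarrow> subalgebra (history (Suc k)) (history_sample i k)"
  unfolding past_and_sample_def
  using sets_history(1)[of i k "Suc k"] subalgebra_history_mono[of k "Suc k"]
  by (intro subalgebra_sigma Un_least) (auto simp: subalgebra_def)

lemma seed_others: "i \<in> {1..n} \<Longrightarrow> j \<in> {1..n} \<Longrightarrow> j \<noteq> i \<Longrightarrow> \<zeta> j k \<in> measurable (others i k) N"
  using sets_others(3)[of j i k] measurable_space[OF seed_measurable]
  by (intro measurable_if_vimage_subset) auto

lemma seed_history: "i \<in> {1..n} \<Longrightarrow> t < k \<Longrightarrow> \<zeta> i t \<in> measurable (history k) N"
  using sets_history(2)[of i t k] measurable_space[OF seed_measurable]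
  by (intro measurable_if_vimage_subset) auto

lemma cond_exp_space: "finite_measure_subalgebra M (history k)"
  by unfold_locales (rule subalgebra_history)

lemma quantize_measurable:
  assumes "u \<in> borel_measurable A" "z \<in> measurable A N"
  shows "(\<lambda>s. Q (u s) (z s)) \<in> borel_measurable A"
proof -
  have "(\<lambda>(x, z). Q x z) \<in> borel_measurable (borel \<Otimes>\<^sub>M N)"
    using quant by (simp add: quantizer_def)
  from measurable_compose[OF measurable_Pair[OF assms] this] show ?thesis by simp
qed

lemma g_eq: "g i k s = Q (gh i k s) (\<zeta> i k s) - grad (fs i) xs"
  using run by (simp add: dqsgd_def)

lemma x_0: "x 0 s = x0" and x_Suc: "x (Suc k) s = x k s - worker_avg n (delayed_update \<gamma> \<tau> g) k s"
  using run by (simp_all add: dqsgd_def)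

lemma g_history: "i \<in> {1..n} \<Longrightarrow> g i k \<in> borel_measurable (history (Suc k))"
  unfolding g_eq[abs_def]
  by (intro borel_measurable_diff borel_measurable_const quantize_measurable seed_history
      measurable_from_subalg[OF subalgebra_history_Suc gh_measurable]) auto

lemma worker_avg_history: "worker_avg n g k \<in> borel_measurable (history (Suc k))"
  unfolding worker_avg_def[abs_def]
  by (intro borel_measurable_scaleR borel_measurable_const borel_measurable_sum g_history)

lemma worker_avg_update:
  "worker_avg n (delayed_update \<gamma> \<tau> g) k s = (if k \<ge> \<tau> then \<gamma> *\<^sub>R worker_avg n g (k - \<tau>) s else 0)"
  by (simp add: worker_avg_def delayed_update_def scaleR_sum_right mult.commute)

text \<open>
  The iterate \<open>x k\<close> is known \<open>\<tau>\<close> steps in advance. For \<open>k < \<tau>\<close> the truncated difference is \<open>0\<close>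
  and the iterate is deterministic.
\<close>

lemma x_history: "x k \<in> borel_measurable (history (k - \<tau>))"
proof (induction k)
  case 0
  have "x 0 = (\<lambda>s. x0)" by (auto simp: x_0)
  then show ?case by simp
next
  case (Suc k)
  have x: "x (Suc k) = (\<lambda>s. x k s - (if k \<ge> \<tau> then \<gamma> *\<^sub>R worker_avg n g (k - \<tau>) s else 0))"
    by (simp add: x_Suc[abs_def] worker_avg_update)
  have "x k \<in> borel_measurable (history (Suc k - \<tau>))"
    by (rule measurable_from_subalg[OF subalgebra_history_mono Suc]) simp
  moreover have "worker_avg n g (k - \<tau>) \<in> borel_measurable (history (Suc k - \<tau>))" if "k \<ge> \<tau>"
    using worker_avg_history[of "k - \<tau>"] that by (simp add: Suc_diff_le)
  ultimately show ?case
    unfolding x by (cases "k \<ge> \<tau>") auto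
qed

lemma x_history': "k - \<tau> \<le> t \<Longrightarrow> x k \<in> borel_measurable (history t)"
  by (rule measurable_from_subalg[OF subalgebra_history_mono x_history])

lemma x_measurable: "x k \<in> borel_measurable M"
  by (rule measurable_from_subalg[OF subalgebra_history x_history])

lemma smooth_f: "smooth_with L f" and convex_f: "convex_on UNIV f"
  and grad_f: "grad f y = (1 / real n) *\<^sub>R (\<Sum>i=1..n. grad (fs i) y)"
  using average_smooth_convex[OF n f_def convex_fs smooth_fs] by auto

lemma f_measurable: "f \<in> borel_measurable borel"
  using convex_f by (intro borel_measurable_continuous_onI convex_on_continuous) auto

lemma grad_f_xs: "grad f xs = 0"
  using smooth_minimizer(2)[OF smooth_f L minimizer] .

lemma grad_measurable: "smooth_with L h \<Longrightarrow> grad h \<in> borel_measurable borel"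
  unfolding smooth_with_def
  by (intro borel_measurable_continuous_onI) (auto intro: lipschitz_on_continuous_on)

definition quant_noise :: "nat \<Rightarrow> nat \<Rightarrow> 'w \<Rightarrow> 'a" where
  "quant_noise i k s = Q (gh i k s) (\<zeta> i k s) - gh i k s"

definition sample_noise :: "nat \<Rightarrow> nat \<Rightarrow> 'w \<Rightarrow> 'a" where
  "sample_noise i k s = gh i k s - grad (fs i) (x k s)"

definition grad_noise :: "nat \<Rightarrow> 'w \<Rightarrow> 'a" where
  "grad_noise k s = worker_avg n g k s - grad f (x k s)"

lemma gh_measurable_M: "i \<in> {1..n} \<Longrightarrow> gh i k \<in> borel_measurable M"
  using gh_mean[of i k] by (auto simp: has_cond_exp_def)

lemma quantization_noiseI:
  assumes "i \<in> {1..n}" "sq_int M (gh i k)"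
  shows "quantization_noise M (others i k) N (\<zeta> i k) Q \<omega> (gh i k)"
    and "quantization_noise.noise (\<zeta> i k) Q (gh i k) = quant_noise i k"
proof -
  show *: "quantization_noise M (others i k) N (\<zeta> i k) Q \<omega> (gh i k)"
    using assms seed_measurable seed_law seed_indep quant \<omega> subalgebra_others
      measurable_from_subalg[OF subalgebra_others_sample gh_measurable]
    by unfold_locales auto
  show "quantization_noise.noise (\<zeta> i k) Q (gh i k) = quant_noise i k"
    using quantization_noise.noise_def[OF *] by (auto simp: quant_noise_def)
qed

lemma sq_int_step:
  assumes x: "sq_int M (x k)" and i: "i \<in> {1..n}"
  shows "sq_int M (\<lambda>s. grad (fs i) (x k s))" "sq_int M (sample_noise i k)" "sq_int M (gh i k)"
    "sq_int M (quant_noise i k)"  "sq_int M (g i k)"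
proof -
  show 1: "sq_int M (\<lambda>s. grad (fs i) (x k s))"
    using smooth_withD(3)[OF smooth_fs[OF i]] by (intro sq_int_lipschitz[OF x] grad_measurable smooth_fs i) auto
  show 2: "sq_int M (sample_noise i k)"
    using gh_variance[OF i, of k] gh_measurable_M[OF i, of k] sq_int_measurable[OF 1]
    by (simp add: sq_int_def sample_noise_def[abs_def] cond_exp_le_def)
  show 3: "sq_int M (gh i k)"
    using sq_int_add[OF 2 1] by (simp add: sample_noise_def)
  show 4: "sq_int M (quant_noise i k)"
    using quantization_noise.sq_int_noise[OF quantization_noiseI(1)[OF i 3]] quantization_noiseI(2)[OF i 3]
    by simp
  have "g i k = (\<lambda>s. quant_noise i k s + gh i k s - grad (fs i) xs)"
    by (auto simp: g_eq quant_noise_def)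
  then show "sq_int M (g i k)"
    by (simp add: sq_int_diff sq_int_add sq_int_const 3 4)
qed

lemma sq_int_worker_avg: "sq_int M (x k) \<Longrightarrow> sq_int M (worker_avg n g k)"
  unfolding worker_avg_def[abs_def] by (intro sq_int_scaleR sq_int_sum sq_int_step)

lemma sq_int_x: "sq_int M (x k)"
proof (induction k rule: less_induct)
  case (less k)
  show ?case
  proof (cases k)
    case 0
    have "x 0 = (\<lambda>s. x0)" by (auto simp: x_0)
    with 0 show ?thesis by (simp add: sq_int_const)
  next
    case (Suc m)
    have "x k = (\<lambda>s. x m s - (if m \<ge> \<tau> then \<gamma> *\<^sub>R worker_avg n g (m - \<tau>) s else 0))"
      by (simp add: Suc x_Suc[abs_def] worker_avg_update)
    then show ?thesis
      using less Suc
      by (cases "m \<ge> \<tau>") (auto intro!: sq_int_diff sq_int_scaleR sq_int_worker_avg)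
  qed
qed

lemmas sq_ints = sq_int_step[OF sq_int_x] sq_int_worker_avg[OF sq_int_x]

lemma sq_int_grad: "sq_int M (\<lambda>s. grad f (x k s))"
  using smooth_withD(3)[OF smooth_f] by (intro sq_int_lipschitz[OF sq_int_x] grad_measurable smooth_f) auto

lemma sq_int_grad_noise: "sq_int M (grad_noise k)"
  unfolding grad_noise_def[abs_def] by (intro sq_int_diff sq_ints sq_int_grad)

lemma integrable_gap: "integrable M (\<lambda>s. f (x k s) - f xs)"
proof -
  have 1: "(\<lambda>s. f (x k s) - f xs) \<in> borel_measurable M"
    using x_measurable f_measurable by simp
  have 2: "integrable M (\<lambda>s. L / 2 * (norm (x k s - xs))\<^sup>2)"
    using sq_int_diff[OF sq_int_x sq_int_const] by (simp add: sq_int_def)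
  have 3: "\<bar>f y - f xs\<bar> \<le> \<bar>L / 2 * (norm (y - xs))\<^sup>2\<bar>" for y
    using descent[OF smooth_f, of xs "y - xs"] minimizer[of y] L by (simp add: grad_f_xs)
  show ?thesis
    by (rule Bochner_Integration.integrable_bound[OF 2 1], rule AE_I2) (simp only: real_norm_def 3)
qed

text \<open>
  The shifts \<open>grad (fs i) xs\<close> cancel in the average because \<open>grad f xs = 0\<close>.
\<close>

lemma grad_noise_eq:
  "grad_noise k s = (1 / real n) *\<^sub>R (\<Sum>i=1..n. quant_noise i k s + sample_noise i k s)"
proof -
  have "(1 / real n) *\<^sub>R (\<Sum>i=1..n. grad (fs i) xs) = 0"
    using grad_f[of xs] grad_f_xs by simp
  then show ?thesis
    unfolding grad_noise_def grad_f[of "x k s"] worker_avg_def g_eq quant_noise_def sample_noise_def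
    by (simp add: sum_subtractf scaleR_diff_right)
qed

lemma quant_noise_orthogonal:
  assumes "i \<in> {1..n}" "Y \<in> borel_measurable (others i k)" "sq_int M Y"
  shows "(\<integral>s. Y s \<bullet> quant_noise i k s \<partial>M) = 0"
proof -
  note q = quantization_noiseI[OF assms(1) sq_ints(3)[OF assms(1)]]
  show ?thesis
    using quantization_noise.noise_orthogonal[OF q(1) assms(2,3)] by (simp only: q(2))
qed

lemma sample_noise_orthogonal:
  assumes "i \<in> {1..n}" "Y \<in> borel_measurable (history k)" "sq_int M Y"
  shows "(\<integral>s. Y s \<bullet> sample_noise i k s \<partial>M) = 0"
  using finite_measure_subalgebra.has_cond_expD[OF cond_exp_space gh_mean[OF assms(1)] sq_ints(3)[OF assms(1)]
      sq_ints(1)[OF assms(1)] assms(3,2)] assms sq_ints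
  by (simp add: sample_noise_def inner_diff_right integrable_inner)

lemma grad_noise_orthogonal:
  assumes Y: "Y \<in> borel_measurable (history k)" "sq_int M Y"
  shows "(\<integral>s. Y s \<bullet> grad_noise k s \<partial>M) = 0"
proof -
  have Yo: "Y \<in> borel_measurable (others i k)" for i
    by (rule measurable_from_subalg[OF subalgebra_others_history Y(1)])
  have "(\<integral>s. Y s \<bullet> grad_noise k s \<partial>M) =
      (\<integral>s. (1 / real n) * (\<Sum>i=1..n. Y s \<bullet> quant_noise i k s + Y s \<bullet> sample_noise i k s) \<partial>M)"
    by (simp add: grad_noise_eq inner_sum_right inner_add_right)
  also have "\<dots> = (1 / real n) * (\<Sum>i=1..n. (\<integral>s. Y s \<bullet> quant_noise i k s \<partial>M) + (\<integral>s. Y s \<bullet> sample_noise i k s \<partial>M))"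
    using sq_ints Y by (simp add: integrable_inner Bochner_Integration.integral_sum)
  also have "\<dots> = 0"
    using Y Yo by (simp add: quant_noise_orthogonal sample_noise_orthogonal)
  finally show ?thesis .
qed

section \<open>Second moment of the gradient noise\<close>

lemma sample_noise_others:
  assumes "i \<in> {1..n}"
  shows "sample_noise i k \<in> borel_measurable (others j k)"
proof -
  have "(\<lambda>s. grad (fs i) (x k s)) \<in> borel_measurable (others j k)"
    using measurable_compose[OF measurable_from_subalg[OF subalgebra_others_history x_history']
        grad_measurable[OF smooth_fs[OF assms]]] by simp
  then show ?thesis
    unfolding sample_noise_def[abs_def]
    by (intro borel_measurable_diff measurable_from_subalg[OF subalgebra_others_sample gh_measurable] assms)
qed

lemma quant_noise_others:
  assumes "i \<in> {1..n}" "j \<in> {1..n}" "i \<noteq> j"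
  shows "quant_noise i k \<in> borel_measurable (others j k)"
  unfolding quant_noise_def[abs_def]
  by (intro borel_measurable_diff quantize_measurable seed_others assms
      measurable_from_subalg[OF subalgebra_others_sample gh_measurable])

lemma indicator_others:
  fixes Y :: "'w \<Rightarrow> 'a"
  assumes "C \<in> sets (history k)" "Y \<in> borel_measurable (others i k)"
  shows "(\<lambda>s. indicator C s *\<^sub>R Y s) \<in> borel_measurable (others i k)"
proof -
  note [measurable] = assms(2) subalgebra_sets[OF subalgebra_others_history[of i k] assms(1)]
  show ?thesis by measurable
qed

lemma history_sets: "C \<in> sets (history k) \<Longrightarrow> C \<in> sets M"
  by (rule subalgebra_sets[OF subalgebra_history])

text \<open>
  Each of the four products contains either a quantization error, whose seed the other factor
  does not involve, or two sampling errors of different workers.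
\<close>

lemma worker_noise_orthogonal:
  assumes C: "C \<in> sets (history k)" and i: "i \<in> {1..n}" and j: "j \<in> {1..n}" and ij: "i \<noteq> j"
  shows "(\<integral>s. (indicator C s *\<^sub>R (quant_noise i k s + sample_noise i k s)) \<bullet>
     (indicator C s *\<^sub>R (quant_noise j k s + sample_noise j k s)) \<partial>M) = 0" (is "?I = 0")
proof -
  note CM = history_sets[OF C]
  let ?c = "\<lambda>X s. indicator C s *\<^sub>R X s"
  have sq: "sq_int M (?c (quant_noise i k))" "sq_int M (?c (sample_noise i k))"
    "sq_int M (?c (sample_noise j k))"
    using sq_ints i j CM by (auto intro!: sq_int_indicator)
  have "?I = (\<integral>s. ((?c (quant_noise i k) s \<bullet> quant_noise j k s + ?c (sample_noise i k) s \<bullet> quant_noise j k s)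
      + ?c (sample_noise j k) s \<bullet> quant_noise i k s) + ?c (sample_noise i k) s \<bullet> sample_noise j k s \<partial>M)"
    by (intro Bochner_Integration.integral_cong refl)
      (auto simp: indicator_def inner_add_left inner_add_right inner_commute)
  also have "\<dots> = (((\<integral>s. ?c (quant_noise i k) s \<bullet> quant_noise j k s \<partial>M)
      + (\<integral>s. ?c (sample_noise i k) s \<bullet> quant_noise j k s \<partial>M))
      + (\<integral>s. ?c (sample_noise j k) s \<bullet> quant_noise i k s \<partial>M))
      + (\<integral>s. ?c (sample_noise i k) s \<bullet> sample_noise j k s \<partial>M)"
    using sq sq_ints i j by (simp add: integrable_inner del: inner_scaleR_left)
  also have "\<dots> = 0"
  proof -
    have "(\<integral>s. ?c (quant_noise i k) s \<bullet> quant_noise j k s \<partial>M) = 0"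
      using i j ij C sq by (intro quant_noise_orthogonal indicator_others quant_noise_others) auto
    moreover have "(\<integral>s. ?c (sample_noise i k) s \<bullet> quant_noise j k s \<partial>M) = 0"
      using i j ij C sq by (intro quant_noise_orthogonal indicator_others sample_noise_others) auto
    moreover have "(\<integral>s. ?c (sample_noise j k) s \<bullet> quant_noise i k s \<partial>M) = 0"
      using i j ij C sq by (intro quant_noise_orthogonal indicator_others sample_noise_others) auto
    moreover have "(\<integral>s. ?c (sample_noise i k) s \<bullet> sample_noise j k s \<partial>M) = 0"
    proof -
      have m: "(\<lambda>s. grad (fs l) (x k s)) \<in> borel_measurable (history k)" if "l \<in> {1..n}" for l
        using measurable_compose[OF x_history' grad_measurable[OF smooth_fs[OF that]], of k k] by simp
      show ?thesis
        unfolding sample_noise_def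
        by (rule finite_measure_subalgebra.cond_indep_orthogonal[OF cond_exp_space gh_indep])
          (use i j ij C m gh_mean sq_ints in auto)
    qed
    ultimately show ?thesis by simp
  qed
  finally show ?thesis .
qed

text \<open>
  The sampling error is orthogonal to the gradient at the current iterate, which belongs to the
  past.
\<close>

lemma gh_second_moment:
  assumes C: "C \<in> sets (history k)" and i: "i \<in> {1..n}"
  shows "(\<integral>s. indicator C s * (norm (gh i k s))\<^sup>2 \<partial>M) =
    (\<integral>s. indicator C s * (norm (sample_noise i k s))\<^sup>2 \<partial>M)
    + (\<integral>s. indicator C s * (norm (grad (fs i) (x k s)))\<^sup>2 \<partial>M)"
proof -
  note CM = history_sets[OF C]
  let ?c = "\<lambda>X s. indicator C s *\<^sub>R X s"
  let ?G = "\<lambda>s. grad (fs i) (x k s)"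
  have sq: "sq_int M (?c ?G)" "sq_int M (?c (sample_noise i k))"
    using sq_ints i CM by (auto intro!: sq_int_indicator)
  have "?G \<in> borel_measurable (history k)"
    using measurable_compose[OF x_history' grad_measurable[OF smooth_fs[OF i]], of k k] by simp
  then have "(\<integral>s. ?c ?G s \<bullet> sample_noise i k s \<partial>M) = 0"
    using i C sq by (intro sample_noise_orthogonal borel_measurable_scaleR) auto
  moreover have "?c ?G s \<bullet> sample_noise i k s = ?c ?G s \<bullet> ?c (sample_noise i k) s" for s
    by (simp add: indicator_def)
  ultimately have "(\<integral>s. ?c ?G s \<bullet> ?c (sample_noise i k) s \<partial>M) = 0" by (simp only:)
  then have "(\<integral>s. (norm (?c ?G s + ?c (sample_noise i k) s))\<^sup>2 \<partial>M) =
    (\<integral>s. (norm (?c ?G s))\<^sup>2 \<partial>M) + (\<integral>s. (norm (?c (sample_noise i k) s))\<^sup>2 \<partial>M)"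
    using integral_norm_add_sq[OF sq] by simp
  moreover have "?c ?G s + ?c (sample_noise i k) s = ?c (gh i k) s" for s
    by (simp add: sample_noise_def flip: scaleR_add_right)
  ultimately show ?thesis by (simp only: norm_indicator_sq)
qed

lemma worker_noise_second_moment:
  assumes C: "C \<in> sets (history k)" and i: "i \<in> {1..n}"
  shows "(\<integral>s. (norm (indicator C s *\<^sub>R (quant_noise i k s + sample_noise i k s)))\<^sup>2 \<partial>M)
    \<le> (\<integral>s. indicator C s * ((\<omega> + 1) * Dw i + \<omega> * (norm (grad (fs i) (x k s)))\<^sup>2) \<partial>M)"
proof -
  note CM = history_sets[OF C]
  let ?c = "\<lambda>X s. indicator C s *\<^sub>R X s"
  have sq: "sq_int M (?c (quant_noise i k))" "sq_int M (?c (sample_noise i k))"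
    using sq_ints i CM by (auto intro!: sq_int_indicator)
  have "(\<integral>s. ?c (sample_noise i k) s \<bullet> quant_noise i k s \<partial>M) = 0"
    using i C sq by (intro quant_noise_orthogonal indicator_others sample_noise_others) auto
  moreover have "?c (sample_noise i k) s \<bullet> quant_noise i k s = ?c (quant_noise i k) s \<bullet> ?c (sample_noise i k) s" for s
    by (simp add: indicator_def inner_commute)
  ultimately have "(\<integral>s. ?c (quant_noise i k) s \<bullet> ?c (sample_noise i k) s \<partial>M) = 0" by (simp only:)
  then have "(\<integral>s. (norm (?c (quant_noise i k) s + ?c (sample_noise i k) s))\<^sup>2 \<partial>M) =
    (\<integral>s. indicator C s * (norm (quant_noise i k s))\<^sup>2 \<partial>M)
    + (\<integral>s. indicator C s * (norm (sample_noise i k s))\<^sup>2 \<partial>M)"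
    using integral_norm_add_sq[OF sq] by (simp only: norm_indicator_sq)
  also have "(\<integral>s. indicator C s * (norm (quant_noise i k s))\<^sup>2 \<partial>M) \<le> \<omega> * (\<integral>s. indicator C s * (norm (gh i k s))\<^sup>2 \<partial>M)"
  proof -
    note q = quantization_noiseI[OF i sq_ints(3)[OF i]]
    show ?thesis
      using quantization_noise.noise_bound[OF q(1) subalgebra_sets[OF subalgebra_others_history C]]
      by (simp only: q(2))
  qed
  finally have 1: "(\<integral>s. (norm (?c (quant_noise i k) s + ?c (sample_noise i k) s))\<^sup>2 \<partial>M)
    \<le> (\<omega> + 1) * (\<integral>s. indicator C s * (norm (sample_noise i k s))\<^sup>2 \<partial>M)
      + \<omega> * (\<integral>s. indicator C s * (norm (grad (fs i) (x k s)))\<^sup>2 \<partial>M)"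
    unfolding gh_second_moment[OF C i] by (simp add: distrib_left distrib_right)
  have 2: "(\<integral>s. indicator C s * (norm (sample_noise i k s))\<^sup>2 \<partial>M) \<le> (\<integral>s. indicator C s * Dw i \<partial>M)"
    unfolding sample_noise_def
    by (rule finite_measure_subalgebra.cond_exp_leD[OF cond_exp_space gh_variance[OF i] _ C]) simp
  have 3: "integrable M (\<lambda>s. indicator C s * Dw i)"
    using integrable_mult_indicator[OF CM integrable_const[of "Dw i"]] by (simp only: real_scaleR_def)
  have 4: "integrable M (\<lambda>s. indicator C s * (norm (grad (fs i) (x k s)))\<^sup>2)"
    using integrable_mult_indicator[OF CM sq_int_integrable_sq[OF sq_ints(1)[OF i]]] by simp
  have "(\<omega> + 1) * (\<integral>s. indicator C s * (norm (sample_noise i k s))\<^sup>2 \<partial>M) \<le> (\<omega> + 1) * (\<integral>s. indicator C s * Dw i \<partial>M)"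
    using 2 \<omega> by (intro mult_left_mono) auto
  also have "(\<omega> + 1) * (\<integral>s. indicator C s * Dw i \<partial>M) + \<omega> * (\<integral>s. indicator C s * (norm (grad (fs i) (x k s)))\<^sup>2 \<partial>M)
    = (\<integral>s. (\<omega> + 1) * (indicator C s * Dw i) + \<omega> * (indicator C s * (norm (grad (fs i) (x k s)))\<^sup>2) \<partial>M)"
    using integrable_mult_right[OF 3, of "\<omega> + 1"] integrable_mult_right[OF 4, of \<omega>]
    by (simp only: Bochner_Integration.integral_add integral_mult_right_zero)
  also have "\<dots> = (\<integral>s. indicator C s * ((\<omega> + 1) * Dw i + \<omega> * (norm (grad (fs i) (x k s)))\<^sup>2) \<partial>M)"
    by (intro Bochner_Integration.integral_cong refl) (simp only: distrib_left mult.left_commute)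
  finally show ?thesis using 1 by (simp only: scaleR_add_right) linarith
qed

text \<open>
  The constant \<open>D1'\<close>; the constant \<open>D3\<close> is \<open>3 \<gamma> \<tau> L\<close> times it.
\<close>

definition noise_level :: real where
  "noise_level = (\<omega> + 1) * ((1 / real n) * (\<Sum>i=1..n. Dw i)) / real n
     + 2 * \<omega> / (real n)\<^sup>2 * (\<Sum>i=1..n. (norm (grad (fs i) xs))\<^sup>2)"

lemma noise_level_nonneg: "noise_level \<ge> 0"
  unfolding noise_level_def using \<omega> Dw by (intro add_nonneg_nonneg mult_nonneg_nonneg divide_nonneg_nonneg sum_nonneg) auto

text \<open>
  Splitting off \<open>grad (fs i) xs\<close> leaves gradient differences, which \<open>grad_diff_bound\<close> controls; the
  linear terms cancel in the sum because \<open>grad f xs = 0\<close>.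
\<close>

lemma sum_grad_sq_le:
  "(\<Sum>i=1..n. (norm (grad (fs i) y))\<^sup>2)
    \<le> 4 * L * real n * (f y - f xs) + 2 * (\<Sum>i=1..n. (norm (grad (fs i) xs))\<^sup>2)"
proof -
  have "(norm (grad (fs i) y))\<^sup>2 \<le> 4 * L * (fs i y - fs i xs - grad (fs i) xs \<bullet> (y - xs))
      + 2 * (norm (grad (fs i) xs))\<^sup>2" if "i \<in> {1..n}" for i
    using norm_add_sq_le[of "grad (fs i) y - grad (fs i) xs" "grad (fs i) xs"]
      grad_diff_bound[OF convex_fs[OF that] smooth_fs[OF that] L, of y xs] by simp
  then have "(\<Sum>i=1..n. (norm (grad (fs i) y))\<^sup>2) \<le>
      (\<Sum>i=1..n. 4 * L * (fs i y - fs i xs - grad (fs i) xs \<bullet> (y - xs)) + 2 * (norm (grad (fs i) xs))\<^sup>2)"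
    by (rule sum_mono)
  also have "\<dots> = 4 * L * ((\<Sum>i=1..n. fs i y) - (\<Sum>i=1..n. fs i xs) - (\<Sum>i=1..n. grad (fs i) xs) \<bullet> (y - xs))
      + 2 * (\<Sum>i=1..n. (norm (grad (fs i) xs))\<^sup>2)"
    by (simp only: sum.distrib sum_distrib_left[symmetric] sum_subtractf inner_sum_left)
  also have "(\<Sum>i=1..n. grad (fs i) xs) = 0"
    using grad_f[of xs] grad_f_xs n by simp
  also have "(\<Sum>i=1..n. fs i y) - (\<Sum>i=1..n. fs i xs) = real n * (f y - f xs)"
    using n by (simp add: f_def right_diff_distrib)
  finally show ?thesis by (simp add: mult.assoc)
qed

lemma grad_noise_second_moment:
  assumes C: "C \<in> sets (history k)"
  shows "(\<integral>s. indicator C s * (norm (grad_noise k s))\<^sup>2 \<partial>M)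
    \<le> (\<integral>s. indicator C s * (4 * L * \<omega> / real n * (f (x k s) - f xs) + noise_level) \<partial>M)"
proof -
  note CM = history_sets[OF C]
  let ?c = "\<lambda>i s. indicator C s *\<^sub>R (quant_noise i k s + sample_noise i k s)"
  let ?h = "\<lambda>i s. indicator C s * ((\<omega> + 1) * Dw i + \<omega> * (norm (grad (fs i) (x k s)))\<^sup>2)"
  have sq: "sq_int M (?c i)" if "i \<in> {1..n}" for i
    using that CM sq_ints by (intro sq_int_indicator sq_int_add) auto
  have ih: "integrable M (?h i)" if "i \<in> {1..n}" for i
    using integrable_mult_indicator[OF CM, of "\<lambda>s. (\<omega> + 1) * Dw i + \<omega> * (norm (grad (fs i) (x k s)))\<^sup>2"]
      sq_int_integrable_sq[OF sq_ints(1)[OF that]] by simp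
  have "(\<integral>s. indicator C s * (norm (grad_noise k s))\<^sup>2 \<partial>M) = (\<integral>s. (1 / real n)\<^sup>2 * (norm (\<Sum>i=1..n. ?c i s))\<^sup>2 \<partial>M)"
    unfolding norm_indicator_sq[symmetric] grad_noise_eq
    by (intro Bochner_Integration.integral_cong refl)
       (simp add: power_mult_distrib flip: scaleR_sum_right, simp add: power_divide power_mult_distrib)
  also have "\<dots> = (1 / real n)\<^sup>2 * (\<Sum>i=1..n. \<integral>s. (norm (?c i s))\<^sup>2 \<partial>M)"
    using pythagoras[of "{1..n}" M ?c] sq worker_noise_orthogonal[OF C] by simp
  also have "\<dots> \<le> (1 / real n)\<^sup>2 * (\<Sum>i=1..n. \<integral>s. ?h i s \<partial>M)"
    using worker_noise_second_moment[OF C] by (intro mult_left_mono sum_mono) auto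
  also have "\<dots> = (\<integral>s. (1 / real n)\<^sup>2 * (\<Sum>i=1..n. ?h i s) \<partial>M)"
    using ih by (subst Bochner_Integration.integral_mult_right_zero, subst Bochner_Integration.integral_sum) auto
  also have "\<dots> \<le> (\<integral>s. indicator C s * (4 * L * \<omega> / real n * (f (x k s) - f xs) + noise_level) \<partial>M)"
  proof (rule integral_mono)
    show "integrable M (\<lambda>s. (1 / real n)\<^sup>2 * (\<Sum>i=1..n. ?h i s))"
      using ih by (intro integrable_mult_right Bochner_Integration.integrable_sum) auto
    show "integrable M (\<lambda>s. indicator C s * (4 * L * \<omega> / real n * (f (x k s) - f xs) + noise_level))"
      using integrable_mult_indicator[OF CM, of "\<lambda>s. 4 * L * \<omega> / real n * (f (x k s) - f xs) + noise_level"]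
        integrable_gap by simp
    fix s
    have "(1 / real n)\<^sup>2 * (\<Sum>i=1..n. ?h i s) =
        indicator C s * ((1 / real n)\<^sup>2 * ((\<omega> + 1) * (\<Sum>i=1..n. Dw i) + \<omega> * (\<Sum>i=1..n. (norm (grad (fs i) (x k s)))\<^sup>2)))"
      by (simp only: sum_distrib_left[symmetric] sum.distrib mult.left_commute)
    also have "\<dots> \<le> indicator C s * ((1 / real n)\<^sup>2 * ((\<omega> + 1) * (\<Sum>i=1..n. Dw i) +
        \<omega> * (4 * L * real n * (f (x k s) - f xs) + 2 * (\<Sum>i=1..n. (norm (grad (fs i) xs))\<^sup>2))))"
      using \<omega> by (intro mult_left_mono add_left_mono sum_grad_sq_le) auto
    also have "\<dots> = indicator C s * (4 * L * \<omega> / real n * (f (x k s) - f xs) + noise_level)"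
    proof -
      have "(1 / real n)\<^sup>2 * ((\<omega> + 1) * d + \<omega> * (4 * L * real n * e + 2 * v)) =
          4 * L * \<omega> / real n * e + ((\<omega> + 1) * ((1 / real n) * d) / real n + 2 * \<omega> / (real n)\<^sup>2 * v)" for d e v
        using n by (simp add: field_simps power2_eq_square)
      then show ?thesis by (simp only: noise_level_def)
    qed
    finally show "(1 / real n)\<^sup>2 * (\<Sum>i=1..n. ?h i s) \<le>
        indicator C s * (4 * L * \<omega> / real n * (f (x k s) - f xs) + noise_level)" .
  qed
  finally show ?thesis .
qed

section \<open>Second moment of the delay error\<close>

abbreviation avg_error :: "nat \<Rightarrow> 'w \<Rightarrow> 'a" where
  "avg_error \<equiv> worker_avg n (delayed_error \<gamma> \<tau> g)"

lemma avg_error_Suc: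
  "avg_error (Suc k) s = avg_error k s + \<gamma> *\<^sub>R worker_avg n g k s - worker_avg n (delayed_update \<gamma> \<tau> g) k s"
  by (simp add: worker_avg_def sum.distrib sum_subtractf scaleR_add_right scaleR_diff_right
      flip: scaleR_sum_right)

text \<open>
  Every step adds the newest vector to the error and, from step \<open>\<tau>\<close> on, removes the oldest one.
\<close>

lemma avg_error_window: "avg_error k s = \<gamma> *\<^sub>R (\<Sum>t\<in>{k - \<tau>..<k}. worker_avg n g t s)"
proof (induction k)
  case 0
  then show ?case by (simp add: worker_avg_def)
next
  case (Suc k)
  show ?case
  proof (cases "k \<ge> \<tau>")
    case True
    have "(\<Sum>t\<in>{k - \<tau>..<Suc k}. worker_avg n g t s)
        = worker_avg n g (k - \<tau>) s + (\<Sum>t\<in>{Suc k - \<tau>..<Suc k}. worker_avg n g t s)"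
      unfolding Suc_diff_le[OF True] by (rule sum.atLeast_Suc_lessThan) simp
    moreover have "(\<Sum>t\<in>{k - \<tau>..<Suc k}. worker_avg n g t s)
        = (\<Sum>t\<in>{k - \<tau>..<k}. worker_avg n g t s) + worker_avg n g k s"
      by (rule sum.atLeastLessThan_Suc) simp
    ultimately have *: "(\<Sum>t\<in>{Suc k - \<tau>..<Suc k}. worker_avg n g t s)
        = (\<Sum>t\<in>{k - \<tau>..<k}. worker_avg n g t s) + worker_avg n g k s - worker_avg n g (k - \<tau>) s"
      by (simp add: algebra_simps)
    show ?thesis
      unfolding avg_error_Suc Suc worker_avg_update *
      using True by (simp add: scaleR_add_right scaleR_diff_right)
  next
    case False
    then show ?thesis
      unfolding avg_error_Suc Suc worker_avg_update by (simp add: scaleR_add_right)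
  qed
qed

lemma sq_int_avg_error: "sq_int M (avg_error k)"
  unfolding avg_error_window[abs_def] by (intro sq_int_scaleR sq_int_sum sq_ints)

lemma avg_error_history: "avg_error k \<in> borel_measurable (history k)"
  unfolding avg_error_window[abs_def]
  by (intro borel_measurable_scaleR borel_measurable_const borel_measurable_sum
      measurable_from_subalg[OF subalgebra_history_mono worker_avg_history]) auto

definition gap :: "nat \<Rightarrow> real" where
  "gap k = (\<integral>s. f (x k s) - f xs \<partial>M)"

lemma gap_nonneg: "gap k \<ge> 0"
  unfolding gap_def using minimizer by (intro Bochner_Integration.integral_nonneg) simp

lemma grad_history: "k - \<tau> \<le> t \<Longrightarrow> (\<lambda>s. grad f (x k s)) \<in> borel_measurable (history t)"
  using measurable_compose[OF x_history' grad_measurable[OF smooth_f]] .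

lemma grad_second_moment: "(\<integral>s. (norm (grad f (x k s)))\<^sup>2 \<partial>M) \<le> 2 * L * gap k"
proof -
  have "(\<integral>s. (norm (grad f (x k s)))\<^sup>2 \<partial>M) \<le> (\<integral>s. 2 * L * (f (x k s) - f xs) \<partial>M)"
    using integrable_gap sq_int_integrable_sq[OF sq_int_grad] smooth_minimizer(1)[OF smooth_f L minimizer]
    by (intro integral_mono integrable_mult_right)
  then show ?thesis by (simp add: gap_def)
qed

lemma grad_noise_variance:
  "(\<integral>s. (norm (grad_noise k s))\<^sup>2 \<partial>M) \<le> 4 * L * \<omega> / real n * gap k + noise_level"
proof -
  have "(\<integral>s. (norm (grad_noise k s))\<^sup>2 \<partial>M) = (\<integral>s. indicator (space M) s * (norm (grad_noise k s))\<^sup>2 \<partial>M)"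
    by (intro Bochner_Integration.integral_cong) auto
  also have "\<dots> \<le> (\<integral>s. indicator (space M) s * (4 * L * \<omega> / real n * (f (x k s) - f xs) + noise_level) \<partial>M)"
    using sets.top[of "history k"] by (intro grad_noise_second_moment) simp
  also have "\<dots> = (\<integral>s. 4 * L * \<omega> / real n * (f (x k s) - f xs) + noise_level \<partial>M)"
    by (intro Bochner_Integration.integral_cong) auto
  also have "\<dots> = 4 * L * \<omega> / real n * gap k + noise_level"
    using integrable_gap[of k] unfolding gap_def
    by (subst Bochner_Integration.integral_add) (simp_all only: integral_mult_right_zero integrable_mult_right
        integrable_const lebesgue_integral_const prob_space, simp)
  finally show ?thesis .
qed

lemma grad_noise_history: "t < k \<Longrightarrow> grad_noise t \<in> borel_measurable (history k)"
  unfolding grad_noise_def[abs_def]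
  by (intro borel_measurable_diff grad_history measurable_from_subalg[OF subalgebra_history_mono worker_avg_history]) auto

lemma grad_noise_pairwise:
  assumes "t \<noteq> u"
  shows "(\<integral>s. grad_noise t s \<bullet> grad_noise u s \<partial>M) = 0"
  using assms
proof (induction t u rule: linorder_wlog)
  case (le t u)
  then show ?case by (intro grad_noise_orthogonal grad_noise_history sq_int_grad_noise) auto
next
  case (sym t u)
  then show ?case by (simp add: inner_commute)
qed

text \<open>
  For \<open>t\<close> and \<open>u\<close> in the window, \<open>t - \<tau> \<le> u\<close>, so the gradient at \<open>x t\<close> belongs to the past of
  step \<open>u\<close> and is orthogonal to the noise of step \<open>u\<close>, even if \<open>t > u\<close>. The noise vectors are
  pairwise orthogonal as well, and the sum of the gradients is estimated by the Cauchy-Schwarz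
  inequality.
\<close>

lemma avg_error_second_moment:
  "(\<integral>s. (norm (avg_error k s))\<^sup>2 \<partial>M)
    \<le> \<gamma>\<^sup>2 * (2 * L * (real \<tau> + 2 * \<omega> / real n) * (\<Sum>t\<in>{k - \<tau>..<k}. gap t) + real \<tau> * noise_level)"
proof -
  let ?W = "{k - \<tau>..<k}"
  have card: "real (card ?W) \<le> real \<tau>" by simp
  define U where "U s = (\<Sum>t\<in>?W. grad f (x t s))" for s
  define V where "V s = (\<Sum>t\<in>?W. grad_noise t s)" for s
  have sq: "sq_int M U" "sq_int M V"
    unfolding U_def[abs_def] V_def[abs_def] by (intro sq_int_sum sq_int_grad sq_int_grad_noise)+
  have "avg_error k s = \<gamma> *\<^sub>R (U s + V s)" for s
    by (simp add: avg_error_window U_def V_def grad_noise_def sum_subtractf)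
  then have "(\<integral>s. (norm (avg_error k s))\<^sup>2 \<partial>M) = \<gamma>\<^sup>2 * (\<integral>s. (norm (U s + V s))\<^sup>2 \<partial>M)"
    by (simp add: power_mult_distrib)
  also have "(\<integral>s. (norm (U s + V s))\<^sup>2 \<partial>M) = (\<integral>s. (norm (U s))\<^sup>2 \<partial>M) + (\<integral>s. (norm (V s))\<^sup>2 \<partial>M)"
  proof -
    have "(\<integral>s. U s \<bullet> grad_noise u s \<partial>M) = 0" if "u \<in> ?W" for u
      unfolding U_def[abs_def] using that
      by (intro grad_noise_orthogonal borel_measurable_sum grad_history sq_int_sum sq_int_grad) auto
    then have "(\<Sum>u\<in>?W. \<integral>s. U s \<bullet> grad_noise u s \<partial>M) = 0" by simp
    moreover have "(\<integral>s. U s \<bullet> V s \<partial>M) = (\<Sum>u\<in>?W. \<integral>s. U s \<bullet> grad_noise u s \<partial>M)"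
      unfolding V_def inner_sum_right using sq by (intro Bochner_Integration.integral_sum integrable_inner sq_int_grad_noise)
    ultimately show ?thesis using integral_norm_add_sq[OF sq] by simp
  qed
  also have "(\<integral>s. (norm (V s))\<^sup>2 \<partial>M) = (\<Sum>t\<in>?W. \<integral>s. (norm (grad_noise t s))\<^sup>2 \<partial>M)"
    unfolding V_def by (intro pythagoras sq_int_grad_noise grad_noise_pairwise) auto
  also have "(\<integral>s. (norm (U s))\<^sup>2 \<partial>M) + (\<Sum>t\<in>?W. \<integral>s. (norm (grad_noise t s))\<^sup>2 \<partial>M)
    \<le> real \<tau> * (\<Sum>t\<in>?W. 2 * L * gap t) + (\<Sum>t\<in>?W. 4 * L * \<omega> / real n * gap t + noise_level)"
  proof (intro add_mono sum_mono grad_noise_variance)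
    have int: "integrable M (\<lambda>s. \<Sum>t\<in>?W. (norm (grad f (x t s)))\<^sup>2)"
      by (intro Bochner_Integration.integrable_sum sq_int_integrable_sq sq_int_grad)
    have "(\<integral>s. (norm (U s))\<^sup>2 \<partial>M) \<le> (\<integral>s. real \<tau> * (\<Sum>t\<in>?W. (norm (grad f (x t s)))\<^sup>2) \<partial>M)"
    proof (rule integral_mono)
      fix s
      have "(norm (U s))\<^sup>2 \<le> real (card ?W) * (\<Sum>t\<in>?W. (norm (grad f (x t s)))\<^sup>2)"
        unfolding U_def by (rule norm_sum_sq_le)
      also have "\<dots> \<le> real \<tau> * (\<Sum>t\<in>?W. (norm (grad f (x t s)))\<^sup>2)"
        by (intro mult_right_mono card sum_nonneg) auto
      finally show "(norm (U s))\<^sup>2 \<le> real \<tau> * (\<Sum>t\<in>?W. (norm (grad f (x t s)))\<^sup>2)" .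
    qed (use sq int in \<open>auto simp: sq_int_integrable_sq\<close>)
    also have "\<dots> = real \<tau> * (\<Sum>t\<in>?W. \<integral>s. (norm (grad f (x t s)))\<^sup>2 \<partial>M)"
      using sq_int_integrable_sq[OF sq_int_grad] by (simp add: Bochner_Integration.integral_sum)
    also have "\<dots> \<le> real \<tau> * (\<Sum>t\<in>?W. 2 * L * gap t)"
      by (intro mult_left_mono sum_mono grad_second_moment) simp
    finally show "(\<integral>s. (norm (U s))\<^sup>2 \<partial>M) \<le> real \<tau> * (\<Sum>t\<in>?W. 2 * L * gap t)" .
  qed
  also have "\<dots> = 2 * L * (real \<tau> + 2 * \<omega> / real n) * (\<Sum>t\<in>?W. gap t) + real (card ?W) * noise_level"
    unfolding sum.distrib sum_distrib_left[symmetric] sum_constant by (simp add: algebra_simps)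
  also have "\<dots> \<le> 2 * L * (real \<tau> + 2 * \<omega> / real n) * (\<Sum>t\<in>?W. gap t) + real \<tau> * noise_level"
    by (intro add_left_mono mult_right_mono card noise_level_nonneg)
  finally show ?thesis by (simp add: mult_left_mono)
qed

lemma worker_avg_mean: "has_cond_exp M (history k) (worker_avg n g k) (\<lambda>s. grad f (x k s))"
proof (rule finite_measure_subalgebra.has_cond_expI[OF cond_exp_space])
  show "integrable M (worker_avg n g k)" "integrable M (\<lambda>s. grad f (x k s))"
    by (intro sq_int_integrable sq_ints sq_int_grad)+
  show "(\<lambda>s. grad f (x k s)) \<in> borel_measurable (history k)" by (intro grad_history) simp
  fix C and b :: 'a assume C: "C \<in> sets (history k)" and b: "b \<in> Basis"
  let ?Y = "\<lambda>s. indicator C s *\<^sub>R b"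
  have Y: "?Y \<in> borel_measurable (history k)" "sq_int M ?Y"
    using C history_sets[OF C] by (auto intro!: borel_measurable_scaleR sq_int_indicator sq_int_const)
  have "0 = (\<integral>s. ?Y s \<bullet> grad_noise k s \<partial>M)" using grad_noise_orthogonal[OF Y] by simp
  also have "\<dots> = (\<integral>s. ?Y s \<bullet> worker_avg n g k s \<partial>M) - (\<integral>s. ?Y s \<bullet> grad f (x k s) \<partial>M)"
    unfolding grad_noise_def inner_diff_right
    by (intro Bochner_Integration.integral_diff integrable_inner Y sq_ints sq_int_grad)
  finally show "(\<integral>s. indicator C s * (worker_avg n g k s \<bullet> b) \<partial>M) = (\<integral>s. indicator C s * (grad f (x k s) \<bullet> b) \<partial>M)"
    by (simp add: inner_commute)
qed

lemma worker_avg_second_moment: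
  "cond_exp_le M (history k) (\<lambda>s. (norm (worker_avg n g k s))\<^sup>2)
     (\<lambda>s. 2 * (L * (1 + 2 * \<omega> / real n)) * (f (x k s) - f xs) + noise_level)"
proof (rule finite_measure_subalgebra.cond_exp_leI[OF cond_exp_space])
  show "integrable M (\<lambda>s. (norm (worker_avg n g k s))\<^sup>2)" by (intro sq_int_integrable_sq sq_ints)
  show "integrable M (\<lambda>s. 2 * (L * (1 + 2 * \<omega> / real n)) * (f (x k s) - f xs) + noise_level)"
    using integrable_gap by simp
  show "(\<lambda>s. 2 * (L * (1 + 2 * \<omega> / real n)) * (f (x k s) - f xs) + noise_level) \<in> borel_measurable (history k)"
    using measurable_compose[OF x_history'[of k k] f_measurable] by simp
  fix C assume C: "C \<in> sets (history k)"
  note CM = history_sets[OF C]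
  let ?c = "\<lambda>X s. indicator C s *\<^sub>R X s"
  let ?G = "\<lambda>s. grad f (x k s)"
  have sq: "sq_int M (?c ?G)" "sq_int M (?c (grad_noise k))"
    by (intro sq_int_indicator sq_int_grad sq_int_grad_noise CM)+
  have "(\<integral>s. ?c ?G s \<bullet> grad_noise k s \<partial>M) = 0"
    using C grad_history[of k k] sq by (intro grad_noise_orthogonal borel_measurable_scaleR) auto
  moreover have "?c ?G s \<bullet> grad_noise k s = ?c ?G s \<bullet> ?c (grad_noise k) s" for s
    by (simp add: indicator_def)
  ultimately have "(\<integral>s. ?c ?G s \<bullet> ?c (grad_noise k) s \<partial>M) = 0" by (simp only:)
  then have "(\<integral>s. (norm (?c ?G s + ?c (grad_noise k) s))\<^sup>2 \<partial>M) =
    (\<integral>s. (norm (?c ?G s))\<^sup>2 \<partial>M) + (\<integral>s. (norm (?c (grad_noise k) s))\<^sup>2 \<partial>M)"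
    using integral_norm_add_sq[OF sq] by simp
  moreover have "?c ?G s + ?c (grad_noise k) s = ?c (worker_avg n g k) s" for s
    by (simp add: grad_noise_def flip: scaleR_add_right)
  ultimately have eq: "(\<integral>s. indicator C s * (norm (worker_avg n g k s))\<^sup>2 \<partial>M) =
      (\<integral>s. indicator C s * (norm (?G s))\<^sup>2 \<partial>M) + (\<integral>s. indicator C s * (norm (grad_noise k s))\<^sup>2 \<partial>M)"
    by (simp only: norm_indicator_sq)
  let ?a = "\<lambda>s. 2 * L * (f (x k s) - f xs)"
  let ?b = "\<lambda>s. 4 * L * \<omega> / real n * (f (x k s) - f xs) + noise_level"
  have ia: "integrable M (\<lambda>s. indicator C s * ?a s)" "integrable M (\<lambda>s. indicator C s * ?b s)"
    using integrable_mult_indicator[OF CM, of ?a] integrable_mult_indicator[OF CM, of ?b] integrable_gap by simp_all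
  have "(\<integral>s. indicator C s * (norm (?G s))\<^sup>2 \<partial>M) \<le> (\<integral>s. indicator C s * ?a s \<partial>M)"
    using ia(1) sq_int_integrable_sq[OF sq(1)] smooth_minimizer(1)[OF smooth_f L minimizer]
    by (intro integral_mono mult_left_mono) (simp_all only: norm_indicator_sq, simp)
  note add_mono[OF this grad_noise_second_moment[OF C], folded eq]
  also have "(\<integral>s. indicator C s * ?a s \<partial>M) + (\<integral>s. indicator C s * ?b s \<partial>M)
      = (\<integral>s. indicator C s * ?a s + indicator C s * ?b s \<partial>M)"
    by (rule Bochner_Integration.integral_add[symmetric, OF ia])
  also have "\<dots> = (\<integral>s. indicator C s * (2 * (L * (1 + 2 * \<omega> / real n)) * (f (x k s) - f xs) + noise_level) \<partial>M)"
    by (intro Bochner_Integration.integral_cong refl) (auto simp: algebra_simps add_divide_distrib)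
  finally show "(\<integral>s. indicator C s * (norm (worker_avg n g k s))\<^sup>2 \<partial>M)
      \<le> (\<integral>s. indicator C s * (2 * (L * (1 + 2 * \<omega> / real n)) * (f (x k s) - f xs) + noise_level) \<partial>M)" .
qed

lemma worker_avg_second_moment_total:
  "(\<integral>s. (norm (worker_avg n g k s))\<^sup>2 \<partial>M) \<le> 2 * (L * (1 + 2 * \<omega> / real n)) * gap k + noise_level"
proof -
  have "integrable M (\<lambda>s. 2 * (L * (1 + 2 * \<omega> / real n)) * (f (x k s) - f xs) + noise_level)"
    using integrable_gap by simp
  from finite_measure_subalgebra.cond_exp_leD[OF cond_exp_space worker_avg_second_moment this, of "space M"]
  have "(\<integral>s. indicator (space M) s * (norm (worker_avg n g k s))\<^sup>2 \<partial>M) \<le>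
      (\<integral>s. indicator (space M) s * (2 * (L * (1 + 2 * \<omega> / real n)) * (f (x k s) - f xs) + noise_level) \<partial>M)"
    using sets.top[of "history k"] by simp
  also have "\<dots> = (\<integral>s. 2 * (L * (1 + 2 * \<omega> / real n)) * (f (x k s) - f xs) + noise_level \<partial>M)"
    by (intro Bochner_Integration.integral_cong) auto
  also have "\<dots> = 2 * (L * (1 + 2 * \<omega> / real n)) * gap k + noise_level"
    using integrable_gap[of k] unfolding gap_def
    by (subst Bochner_Integration.integral_add) (simp_all only: integral_mult_right_zero integrable_mult_right
        integrable_const lebesgue_integral_const prob_space, simp)
  also have "(\<integral>s. indicator (space M) s * (norm (worker_avg n g k s))\<^sup>2 \<partial>M) = (\<integral>s. (norm (worker_avg n g k s))\<^sup>2 \<partial>M)"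
    by (intro Bochner_Integration.integral_cong) auto
  finally show ?thesis .
qed

end

section \<open>Convergence under the step size condition\<close>

text \<open>
  The two step size conditions with the divisions and the square root removed;
  \<open>128 = 8\<^sup>2 * 2\<close>.
\<close>

locale dqsgd_stepsize = dqsgd_process +
  fixes \<mu> :: real
  assumes \<mu>: "\<mu> \<ge> 0" and qsc: "quasi_strongly_convex \<mu> f xs" and \<gamma>: "\<gamma> > 0"
    and step1: "4 * (L * (1 + 2 * \<omega> / real n)) * \<gamma> \<le> 1"
    and step2: "128 * L\<^sup>2 * (real \<tau> * (real \<tau> + 1 + 2 * \<omega> / real n)) * \<gamma>\<^sup>2 \<le> 1"
begin

lemma \<mu>_le_L: "\<mu> \<le> L"
  by (rule quasi_strong_convexity_le_smoothness[OF smooth_f L qsc \<mu>])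

text \<open>
  With \<open>\<mu> \<le> L\<close> this makes \<open>\<gamma> \<mu> / 2\<close> the smallest of the three terms in \<open>rate\<close>.
\<close>

lemma \<gamma>L: "\<gamma> * L \<le> 1 / 4"
proof -
  have "4 * (L * 1) * \<gamma> \<le> 4 * (L * (1 + 2 * \<omega> / real n)) * \<gamma>"
    using L \<omega> \<gamma> by (intro mult_right_mono mult_left_mono) auto
  with step1 show ?thesis by (simp add: mult_ac)
qed

lemma rate_eq: "rate \<gamma> \<mu> 1 1 = \<gamma> * \<mu> / 2"
proof -
  have "\<gamma> * \<mu> \<le> \<gamma> * L" using \<mu>_le_L \<gamma> by simp
  then show ?thesis using \<gamma>L by (simp add: rate_def)
qed

lemma rate_bounds: "0 \<le> rate \<gamma> \<mu> 1 1" "rate \<gamma> \<mu> 1 1 < 1" "real \<tau> * rate \<gamma> \<mu> 1 1 \<le> 1 / 2"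
proof -
  have m: "\<gamma> * \<mu> \<le> \<gamma> * L" using \<mu>_le_L \<gamma> by simp
  show "0 \<le> rate \<gamma> \<mu> 1 1" using \<gamma> \<mu> by (simp add: rate_eq)
  show "rate \<gamma> \<mu> 1 1 < 1" using m \<gamma>L by (simp add: rate_eq)
  have "(real \<tau> * (\<gamma> * L))\<^sup>2 = L\<^sup>2 * (real \<tau> * real \<tau>) * \<gamma>\<^sup>2"
    by (simp add: power2_eq_square)
  also have "\<dots> \<le> (128 * L\<^sup>2) * (real \<tau> * (real \<tau> + 1 + 2 * \<omega> / real n)) * \<gamma>\<^sup>2"
    using \<omega> by (intro mult_right_mono mult_mono mult_left_mono) auto
  also have "\<dots> \<le> 1\<^sup>2" using step2 by simp
  finally have "real \<tau> * (\<gamma> * L) \<le> 1" by (rule power2_le_imp_le) simp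
  moreover have "real \<tau> * (\<gamma> * \<mu>) \<le> real \<tau> * (\<gamma> * L)" by (rule mult_left_mono[OF m]) simp
  ultimately show "real \<tau> * rate \<gamma> \<mu> 1 1 \<le> 1 / 2" by (simp add: rate_eq)
qed

abbreviation wt :: "nat \<Rightarrow> real" where "wt \<equiv> weight (rate \<gamma> \<mu> 1 1)"

lemma wt_pos: "wt k > 0" by (rule weight_pos[OF rate_bounds(2)])

text \<open>
  The gaps receive the factor \<open>3 L * 2 L (\<tau> + 2 \<omega> / n) \<gamma>\<^sup>2 * 2 \<tau>\<close>, which the second step size
  condition bounds by \<open>12 / 128\<close>.
\<close>

lemma weighted_error_sum:
  "3 * L * (\<Sum>k=0..K. wt k * (\<integral>s. (norm (avg_error k s))\<^sup>2 \<partial>M))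
    \<le> 1 / 4 * (\<Sum>k=0..K. wt k * gap k)
      + \<gamma> * (3 * \<gamma> * real \<tau> * L * noise_level) * weight_sum (rate \<gamma> \<mu> 1 1) K"
proof -
  define c where "c = real \<tau> + 2 * \<omega> / real n"
  have c: "c \<ge> 0" using \<omega> by (simp add: c_def)
  let ?A = "\<Sum>k=0..K. wt k * (\<Sum>t\<in>{k - \<tau>..<k}. gap t)" and ?B = "\<Sum>k=0..K. wt k * gap k"
  have "(\<Sum>k=0..K. wt k * (\<integral>s. (norm (avg_error k s))\<^sup>2 \<partial>M))
      \<le> (\<Sum>k=0..K. wt k * (\<gamma>\<^sup>2 * (2 * L * c * (\<Sum>t\<in>{k - \<tau>..<k}. gap t) + real \<tau> * noise_level)))"
    unfolding c_def using wt_pos by (intro sum_mono mult_left_mono avg_error_second_moment) (auto intro: less_imp_le)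
  also have "\<dots> = \<gamma>\<^sup>2 * (2 * L * c) * ?A + \<gamma>\<^sup>2 * (real \<tau> * noise_level) * weight_sum (rate \<gamma> \<mu> 1 1) K"
  proof -
    have "(\<Sum>k=0..K. wt k * (\<gamma>\<^sup>2 * (2 * L * c * h k + real \<tau> * noise_level)))
        = \<gamma>\<^sup>2 * (2 * L * c) * (\<Sum>k=0..K. wt k * h k)
          + \<gamma>\<^sup>2 * (real \<tau> * noise_level) * weight_sum (rate \<gamma> \<mu> 1 1) K" for h :: "nat \<Rightarrow> real"
      unfolding weight_sum_def sum_distrib_left sum.distrib[symmetric]
      by (intro sum.cong refl) (simp add: algebra_simps)
    then show ?thesis .
  qed
  also have "\<dots> \<le> \<gamma>\<^sup>2 * (2 * L * c) * (2 * real \<tau> * ?B) + \<gamma>\<^sup>2 * (real \<tau> * noise_level) * weight_sum (rate \<gamma> \<mu> 1 1) K"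
    using c L by (intro add_right_mono mult_left_mono weighted_window_sum rate_bounds gap_nonneg) auto
  finally have "3 * L * (\<Sum>k=0..K. wt k * (\<integral>s. (norm (avg_error k s))\<^sup>2 \<partial>M))
      \<le> 3 * L * (\<gamma>\<^sup>2 * (2 * L * c) * (2 * real \<tau> * ?B) + \<gamma>\<^sup>2 * (real \<tau> * noise_level) * weight_sum (rate \<gamma> \<mu> 1 1) K)"
    using L by (intro mult_left_mono) auto
  also have "\<dots> = (12 * L\<^sup>2 * (real \<tau> * c) * \<gamma>\<^sup>2) * ?B
      + \<gamma> * (3 * \<gamma> * real \<tau> * L * noise_level) * weight_sum (rate \<gamma> \<mu> 1 1) K"
    by (simp add: power2_eq_square algebra_simps)
  also have "\<dots> \<le> 1 / 4 * ?B + \<gamma> * (3 * \<gamma> * real \<tau> * L * noise_level) * weight_sum (rate \<gamma> \<mu> 1 1) K"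
  proof (intro add_right_mono mult_right_mono)
    have "L\<^sup>2 * (real \<tau> * c) * \<gamma>\<^sup>2 \<le> L\<^sup>2 * (real \<tau> * (real \<tau> + 1 + 2 * \<omega> / real n)) * \<gamma>\<^sup>2"
      unfolding c_def by (intro mult_right_mono mult_left_mono) auto
    with step2 show "12 * L\<^sup>2 * (real \<tau> * c) * \<gamma>\<^sup>2 \<le> 1 / 4" by simp
    show "0 \<le> ?B" using wt_pos gap_nonneg by (intro sum_nonneg mult_nonneg_nonneg) (auto intro: less_imp_le)
  qed
  finally show ?thesis .
qed

definition virtual_dist :: "nat \<Rightarrow> real" where
  "virtual_dist k = (\<integral>s. (norm (x k s - avg_error k s - xs))\<^sup>2 \<partial>M)"

text \<open>
  The step of the virtual iterate involves no delay. Its noise is orthogonal to the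
  virtual iterate, which belongs to the past; the first step size condition lets half of the
  remaining gap pay for the gap term in the second moment of \<open>worker_avg n g k\<close>.
\<close>

lemma virtual_step:
  "virtual_dist (Suc k) \<le> (1 - rate \<gamma> \<mu> 1 1) * virtual_dist k - \<gamma> / 2 * gap k
     + 3 * L * \<gamma> * (\<integral>s. (norm (avg_error k s))\<^sup>2 \<partial>M) + \<gamma>\<^sup>2 * noise_level"
proof -
  let ?y = "\<lambda>s. x k s - avg_error k s - xs"
  let ?E = "\<integral>s. (norm (avg_error k s))\<^sup>2 \<partial>M"
  have y: "sq_int M ?y" by (intro sq_int_diff sq_int_x sq_int_avg_error sq_int_const)
  have yh: "?y \<in> borel_measurable (history k)"
    by (intro borel_measurable_diff x_history' avg_error_history borel_measurable_const) simp
  have gs: "sq_int M (\<lambda>s. (- \<gamma>) *\<^sub>R worker_avg n g k s)" by (intro sq_int_scaleR sq_ints)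
  have "x (Suc k) s - avg_error (Suc k) s - xs = ?y s + (- \<gamma>) *\<^sub>R worker_avg n g k s" for s
    by (simp add: x_Suc avg_error_Suc)
  then have "virtual_dist (Suc k) = (\<integral>s. (norm (?y s + (- \<gamma>) *\<^sub>R worker_avg n g k s))\<^sup>2 \<partial>M)"
    by (simp only: virtual_dist_def)
  also have "\<dots> = virtual_dist k + 2 * (\<integral>s. ?y s \<bullet> ((- \<gamma>) *\<^sub>R worker_avg n g k s) \<partial>M)
      + (\<integral>s. (norm ((- \<gamma>) *\<^sub>R worker_avg n g k s))\<^sup>2 \<partial>M)"
    unfolding virtual_dist_def by (rule integral_norm_add_sq[OF y gs])
  also have "(\<integral>s. (norm ((- \<gamma>) *\<^sub>R worker_avg n g k s))\<^sup>2 \<partial>M) = \<gamma>\<^sup>2 * (\<integral>s. (norm (worker_avg n g k s))\<^sup>2 \<partial>M)"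
    by (simp add: power_mult_distrib)
  also have "(\<integral>s. ?y s \<bullet> ((- \<gamma>) *\<^sub>R worker_avg n g k s) \<partial>M) = - \<gamma> * (\<integral>s. ?y s \<bullet> worker_avg n g k s \<partial>M)"
    by (simp only: inner_scaleR_right integral_mult_right_zero)
  also have "(\<integral>s. ?y s \<bullet> worker_avg n g k s \<partial>M) = (\<integral>s. ?y s \<bullet> grad f (x k s) \<partial>M)"
  proof -
    have "worker_avg n g k s = grad f (x k s) + grad_noise k s" for s by (simp add: grad_noise_def)
    then have "(\<integral>s. ?y s \<bullet> worker_avg n g k s \<partial>M) = (\<integral>s. ?y s \<bullet> grad f (x k s) + ?y s \<bullet> grad_noise k s \<partial>M)"
      by (simp only: inner_add_right)
    also have "\<dots> = (\<integral>s. ?y s \<bullet> grad f (x k s) \<partial>M) + (\<integral>s. ?y s \<bullet> grad_noise k s \<partial>M)"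
      by (intro Bochner_Integration.integral_add integrable_inner y sq_int_grad sq_int_grad_noise)
    finally show ?thesis using grad_noise_orthogonal[OF yh y] by simp
  qed
  finally have 1: "virtual_dist (Suc k) = virtual_dist k + \<gamma> * (- 2 * (\<integral>s. ?y s \<bullet> grad f (x k s) \<partial>M))
      + \<gamma>\<^sup>2 * (\<integral>s. (norm (worker_avg n g k s))\<^sup>2 \<partial>M)" by simp
  have "- 2 * (\<integral>s. ?y s \<bullet> grad f (x k s) \<partial>M) = (\<integral>s. - 2 * (?y s \<bullet> grad f (x k s)) \<partial>M)"
    by (simp only: integral_mult_right_zero)
  also have "\<dots> \<le> (\<integral>s. - (f (x k s) - f xs) - \<mu> / 2 * (norm (?y s))\<^sup>2 + 3 * L * (norm (avg_error k s))\<^sup>2 \<partial>M)"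
  proof (rule integral_mono)
    show "integrable M (\<lambda>s. - 2 * (?y s \<bullet> grad f (x k s)))"
      by (intro integrable_mult_right integrable_inner y sq_int_grad)
    show "integrable M (\<lambda>s. - (f (x k s) - f xs) - \<mu> / 2 * (norm (?y s))\<^sup>2 + 3 * L * (norm (avg_error k s))\<^sup>2)"
      by (intro Bochner_Integration.integrable_add Bochner_Integration.integrable_diff integrable_minus
          integrable_mult_right integrable_gap sq_int_integrable_sq y sq_int_avg_error)
    show "- 2 * (?y s \<bullet> grad f (x k s)) \<le> - (f (x k s) - f xs) - \<mu> / 2 * (norm (?y s))\<^sup>2 + 3 * L * (norm (avg_error k s))\<^sup>2" for s
      by (rule virtual_step_descent[OF smooth_f L qsc \<mu>])
  qed
  also have "\<dots> = - gap k - \<mu> / 2 * virtual_dist k + 3 * L * ?E"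
    unfolding gap_def virtual_dist_def
    using integrable_gap[of k] sq_int_integrable_sq[OF y] sq_int_integrable_sq[OF sq_int_avg_error[of k]]
    by (simp only: Bochner_Integration.integral_add Bochner_Integration.integral_diff integral_minus integral_mult_right_zero
        Bochner_Integration.integrable_diff Bochner_Integration.integrable_add integrable_minus integrable_mult_right)
  finally have "\<gamma> * (- 2 * (\<integral>s. ?y s \<bullet> grad f (x k s) \<partial>M)) \<le> \<gamma> * (- gap k - \<mu> / 2 * virtual_dist k + 3 * L * ?E)"
    using \<gamma> by (intro mult_left_mono) auto
  moreover have "\<gamma>\<^sup>2 * (\<integral>s. (norm (worker_avg n g k s))\<^sup>2 \<partial>M) \<le> \<gamma> / 2 * gap k + \<gamma>\<^sup>2 * noise_level"
  proof -
    define a where "a = L * (1 + 2 * \<omega> / real n)"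
    have "\<gamma>\<^sup>2 * (\<integral>s. (norm (worker_avg n g k s))\<^sup>2 \<partial>M) \<le> \<gamma>\<^sup>2 * (2 * a * gap k + noise_level)"
      unfolding a_def by (intro mult_left_mono worker_avg_second_moment_total) simp
    also have "\<dots> = (4 * a * \<gamma>) * (\<gamma> / 2 * gap k) + \<gamma>\<^sup>2 * noise_level"
      by (simp add: power2_eq_square algebra_simps)
    also have "(4 * a * \<gamma>) * (\<gamma> / 2 * gap k) \<le> 1 * (\<gamma> / 2 * gap k)"
      using step1 \<gamma> gap_nonneg unfolding a_def by (intro mult_right_mono) auto
    finally show ?thesis by simp
  qed
  ultimately have "virtual_dist (Suc k) \<le> virtual_dist k + \<gamma> * (- gap k - \<mu> / 2 * virtual_dist k + 3 * L * ?E)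
      + (\<gamma> / 2 * gap k + \<gamma>\<^sup>2 * noise_level)"
    using 1 by linarith
  also have "\<dots> = (1 - rate \<gamma> \<mu> 1 1) * virtual_dist k - \<gamma> / 2 * gap k + 3 * L * \<gamma> * ?E + \<gamma>\<^sup>2 * noise_level"
    by (simp add: rate_eq algebra_simps)
  finally show ?thesis .
qed

lemma weighted_gap_sum:
  "(\<Sum>k=0..K. wt k * gap k) \<le> 4 * (norm (x0 - xs))\<^sup>2 / \<gamma>
     + 4 * \<gamma> * (noise_level + 3 * \<gamma> * real \<tau> * L * noise_level) * weight_sum (rate \<gamma> \<mu> 1 1) K"
proof -
  have "avg_error 0 s = 0" for s by (simp add: avg_error_window)
  then have "virtual_dist 0 = (norm (x0 - xs))\<^sup>2"
    by (simp add: virtual_dist_def x_0 prob_space)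
  moreover have "virtual_dist k \<ge> 0" for k by (simp add: virtual_dist_def)
  ultimately show ?thesis
    using weighted_recursion[OF rate_bounds(2) \<gamma> _ virtual_step weighted_error_sum, of K] by simp
qed

text \<open>
  The gap at the averaged iterate lies between \<open>0\<close> and the weighted average of the gaps, which
  yields integrability together with the bound.
\<close>

lemma jensen_gap:
  defines "W \<equiv> weight_sum (rate \<gamma> \<mu> 1 1)"
  shows "integrable M (\<lambda>s. f (weighted_avg (rate \<gamma> \<mu> 1 1) x K s) - f xs)"
    and "(\<integral>s. f (weighted_avg (rate \<gamma> \<mu> 1 1) x K s) - f xs \<partial>M) \<le> (\<Sum>k=0..K. wt k * gap k) / W K"
proof -
  let ?z = "weighted_avg (rate \<gamma> \<mu> 1 1) x K"
  let ?h = "\<lambda>s. \<Sum>k=0..K. wt k / W K * (f (x k s) - f xs)"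
  have W: "W K > 0" unfolding W_def by (rule weight_sum_pos[OF rate_bounds(2)])
  have sum1: "(\<Sum>k=0..K. wt k / W K) = 1"
    using W by (simp add: W_def weight_sum_def flip: sum_divide_distrib)
  have le: "f (?z s) - f xs \<le> ?h s" for s
  proof -
    have "f (?z s) = f (\<Sum>k=0..K. (wt k / W K) *\<^sub>R x k s)"
      by (simp add: weighted_avg_def W_def scaleR_sum_right)
    also have "\<dots> \<le> (\<Sum>k=0..K. wt k / W K * f (x k s))"
      using W sum1 wt_pos by (intro convex_on_sum[OF _ _ convex_f]) (auto intro: less_imp_le)
    also have "\<dots> = ?h s + f xs"
      unfolding right_diff_distrib sum_subtractf sum_distrib_right[symmetric] sum1 by simp
    finally show ?thesis by simp
  qed
  have ih: "integrable M ?h" by (intro Bochner_Integration.integrable_sum integrable_mult_right integrable_gap)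
  have "?z \<in> borel_measurable M"
    unfolding weighted_avg_def[abs_def]
    by (intro borel_measurable_scaleR borel_measurable_const borel_measurable_sum x_measurable)
  then have "(\<lambda>s. f (?z s) - f xs) \<in> borel_measurable M" using f_measurable by simp
  then show int: "integrable M (\<lambda>s. f (?z s) - f xs)"
  proof (rule Bochner_Integration.integrable_bound[OF ih], intro AE_I2)
    show "norm (f (?z s) - f xs) \<le> norm (?h s)" for s
      using le[of s] minimizer[of "?z s"] by simp
  qed
  have "(\<integral>s. f (?z s) - f xs \<partial>M) \<le> (\<integral>s. ?h s \<partial>M)"
    using int ih le by (rule integral_mono)
  also have "\<dots> = (\<Sum>k=0..K. wt k * gap k) / W K"
    by (simp add: gap_def Bochner_Integration.integral_sum integrable_gap sum_divide_distrib)
  finally show "(\<integral>s. f (?z s) - f xs \<partial>M) \<le> (\<Sum>k=0..K. wt k * gap k) / W K" .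
qed

lemma expected_gap:
  "(\<integral>s. f (weighted_avg (rate \<gamma> \<mu> 1 1) x K s) - f xs \<partial>M)
    \<le> 1 / weight_sum (rate \<gamma> \<mu> 1 1) K * (4 * (norm (x0 - xs))\<^sup>2 / \<gamma>)
      + 4 * \<gamma> * (noise_level + 3 * \<gamma> * real \<tau> * L * noise_level)"
proof -
  let ?W = "weight_sum (rate \<gamma> \<mu> 1 1) K"
  have W: "?W > 0" by (rule weight_sum_pos[OF rate_bounds(2)])
  have "(\<Sum>k=0..K. wt k * gap k) / ?W \<le> (4 * (norm (x0 - xs))\<^sup>2 / \<gamma>
      + 4 * \<gamma> * (noise_level + 3 * \<gamma> * real \<tau> * L * noise_level) * ?W) / ?W"
    using W by (intro divide_right_mono weighted_gap_sum) simp
  also have "\<dots> = 1 / ?W * (4 * (norm (x0 - xs))\<^sup>2 / \<gamma>)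
      + 4 * \<gamma> * (noise_level + 3 * \<gamma> * real \<tau> * L * noise_level)"
    using W by (simp add: add_divide_distrib)
  finally show ?thesis using jensen_gap(2)[of K] by linarith
qed

lemma inverse_weight_sum: "1 / weight_sum (rate \<gamma> \<mu> 1 1) K \<le> (1 - rate \<gamma> \<mu> 1 1) ^ K"
proof -
  define q where "q = 1 - rate \<gamma> \<mu> 1 1"
  have q: "0 < q" "q \<le> 1" using rate_bounds by (simp_all add: q_def)
  have "1 / q ^ K \<le> 1 / q ^ Suc K"
    using q by (intro divide_left_mono power_decreasing) auto
  also have "\<dots> = wt K" by (simp add: weight_eq q_def)
  also have "\<dots> \<le> weight_sum (rate \<gamma> \<mu> 1 1) K"
    unfolding weight_sum_def using wt_pos by (intro member_le_sum) (auto intro: less_imp_le)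
  finally have "1 / weight_sum (rate \<gamma> \<mu> 1 1) K \<le> 1 / (1 / q ^ K)"
    using q by (intro divide_left_mono mult_pos_pos weight_sum_pos[OF rate_bounds(2)]) auto
  then show ?thesis by (simp add: q_def)
qed

end

theorem theoremK2:
  fixes fs :: "nat \<Rightarrow> 'a::euclidean_space \<Rightarrow> real"
    and f :: "'a \<Rightarrow> real"
    and x0 xs :: 'a
    and n \<tau> :: nat
    and L \<mu> \<omega> \<gamma> D D1' D3 :: real
    and Dw :: "nat \<Rightarrow> real"
    and M :: "'w measure"
    and N :: "'z measure"
    and Q :: "'a \<Rightarrow> 'z \<Rightarrow> 'a"
    and S :: "nat \<Rightarrow> 'x measure"
    and \<xi> :: "nat \<Rightarrow> nat \<Rightarrow> 'w \<Rightarrow> 'x"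
    and \<zeta> :: "nat \<Rightarrow> nat \<Rightarrow> 'w \<Rightarrow> 'z"
    and gh g :: "nat \<Rightarrow> nat \<Rightarrow> 'w \<Rightarrow> 'a"
    and x :: "nat \<Rightarrow> 'w \<Rightarrow> 'a"
  assumes "n \<ge> 1"
    and "f = (\<lambda>y. (1 / real n) * (\<Sum>i=1..n. fs i y))"
    and "\<And>i. i \<in> {1..n} \<Longrightarrow> convex_on UNIV (fs i)"
    and "\<And>i. i \<in> {1..n} \<Longrightarrow> smooth_with L (fs i)"
    and "\<mu> \<ge> 0"
    and "quasi_strongly_convex \<mu> f xs"
    and "\<omega> > 0"
    and "quantizer N Q \<omega>"
    and "\<tau> \<ge> 1"
    and "\<And>i. i \<in> {1..n} \<Longrightarrow> Dw i \<ge> 0"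
    and "dqsgd M n fs xs \<gamma> \<tau> x0 N Q Dw S \<xi> \<zeta> gh g x"
    and "0 < \<gamma>"
    and "\<gamma> \<le> min (1 / (4 * L * (1 + 2 * \<omega> / real n)))
                 (1 / (8 * L * sqrt (2 * real \<tau> * (real \<tau> + 1 + 2 * \<omega> / real n))))"
    and "D = (1 / real n) * (\<Sum>i=1..n. Dw i)"
    and "D1' = (\<omega> + 1) * D / real n
               + 2 * \<omega> / (real n)\<^sup>2 * (\<Sum>i=1..n. (norm (grad (fs i) xs))\<^sup>2)"
    and "D3 = 3 * \<gamma> * real \<tau> * L / real n
               * ((\<omega> + 1) * D + 2 * \<omega> / real n * (\<Sum>i=1..n. (norm (grad (fs i) xs))\<^sup>2))"
  shows "parametric_assumption M (past M n S N \<xi> \<zeta>) f xs L \<mu> \<gamma> x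
           (worker_avg n g) (worker_avg n (delayed_error \<gamma> \<tau> g))
           (\<lambda>k s. 0) (\<lambda>k s. 0)
           (L * (1 + 2 * \<omega> / real n)) 0 0 D1' 1 1 0 0 0 0 0 0 D3
       \<and> (\<forall>K. integrable M (\<lambda>s. f (weighted_avg (rate \<gamma> \<mu> 1 1) x K s) - f xs))
       \<and> (\<mu> > 0 \<longrightarrow> (\<forall>K.
            (\<integral>s. f (weighted_avg (rate \<gamma> \<mu> 1 1) x K s) - f xs \<partial>M)
            \<le> (1 - \<gamma> * \<mu> / 2) ^ K * (4 * (norm (x0 - xs))\<^sup>2 / \<gamma>) + 4 * \<gamma> * (D1' + D3)))
       \<and> (\<mu> = 0 \<longrightarrow> (\<forall>K\<ge>1.
            (\<integral>s. f (weighted_avg (rate \<gamma> \<mu> 1 1) x K s) - f xs \<partial>M)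
            \<le> 4 * (norm (x0 - xs))\<^sup>2 / (\<gamma> * real K) + 4 * \<gamma> * (D1' + D3)))"
proof -
  have f: "f = (\<lambda>y. (1 / real n) * (\<Sum>i=1..n. fs i y))"
    and sm: "smooth_with L (fs i)" if "i \<in> {1..n}" for i
    using assms(2,4) that by blast+
  have n: "real n \<ge> 1" using assms(1) by simp
  have "L \<ge> 0" using smooth_withD(2)[OF sm, of 1] assms(1) by simp
  have "L \<noteq> 0" using assms(12,13) by auto
  with \<open>L \<ge> 0\<close> have L: "L > 0" by simp
  define a where "a = 1 + 2 * \<omega> / real n"
  have a: "a > 0" using assms(7) n by (simp add: a_def add_pos_nonneg)
  have \<tau>: "real \<tau> \<ge> 1" using assms(9) by simp
  have "\<gamma> \<le> 1 / (4 * L * a)" using assms(13) by (simp add: a_def)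
  then have step1: "4 * (L * a) * \<gamma> \<le> 1"
    using L a by (simp add: pos_le_divide_eq mult_ac)
  define b where "b = real \<tau> * (real \<tau> + 1 + 2 * \<omega> / real n)"
  have b: "b > 0" using \<tau> a by (simp add: b_def a_def add.assoc add_pos_pos)
  have "\<gamma> \<le> 1 / (8 * L * sqrt (2 * b))" using assms(13) by (simp add: b_def mult.assoc)
  then have "\<gamma> * (8 * L * sqrt (2 * b)) \<le> 1"
    using L b by (simp add: pos_le_divide_eq)
  then have "(\<gamma> * (8 * L * sqrt (2 * b)))\<^sup>2 \<le> 1\<^sup>2"
    using L b assms(12) by (intro power_mono) auto
  then have step2: "128 * L\<^sup>2 * b * \<gamma>\<^sup>2 \<le> 1"
    using b by (simp add: power_mult_distrib mult_ac)
  have min: "f xs \<le> f y" for y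
    using assms(6) by (simp add: quasi_strongly_convex_def is_unique_minimizer_def)
  interpret dqsgd_stepsize M n fs xs \<gamma> \<tau> x0 N Q \<omega> Dw S \<xi> \<zeta> gh g x L f \<mu>
    by unfold_locales
      (use assms L min step1 step2 in \<open>auto simp: a_def b_def\<close>)
  have D1: "D1' = noise_level"
    by (simp add: assms(14,15) noise_level_def)
  have D3: "D3 = 3 * \<gamma> * real \<tau> * L * noise_level"
    using n by (simp add: assms(14,16) noise_level_def field_simps power2_eq_square)
  have zero: "cond_exp_le M (history k) (\<lambda>s. 0\<^sup>2) (\<lambda>s. 0)" for k
    by (rule finite_measure_subalgebra.cond_exp_leI[OF cond_exp_space]) auto
  have "parametric_assumption M history f xs L \<mu> \<gamma> x (worker_avg n g) avg_error
      (\<lambda>k s. 0) (\<lambda>k s. 0) (L * (1 + 2 * \<omega> / real n)) 0 0 D1' 1 1 0 0 0 0 0 0 D3"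
    unfolding parametric_assumption_def Let_def
  proof (intro conjI allI)
    show "has_cond_exp M (history k) (worker_avg n g k) (\<lambda>s. grad f (x k s))" for k
      by (rule worker_avg_mean)
  next
    show "cond_exp_le M (history k) (\<lambda>s. (norm (worker_avg n g k s))\<^sup>2)
        (\<lambda>s. 2 * (L * (1 + 2 * \<omega> / real n)) * (f (x k s) - f xs) + 0 * 0\<^sup>2 + 0 * 0\<^sup>2 + D1')" for k
      using worker_avg_second_moment[of k] by (simp add: D1)
  next
    show "integrable M (\<lambda>s. (norm (avg_error k s))\<^sup>2)" for k
      by (rule sq_int_integrable_sq[OF sq_int_avg_error])
  next
    show "integrable M (\<lambda>s. f (x k s) - f xs)" for k
      by (rule integrable_gap)
  next
    show "AE s in M. 3 * L * (\<Sum>k=0..K. weight (rate \<gamma> \<mu> 1 1) k * (\<integral>t. (norm (avg_error k t))\<^sup>2 \<partial>M))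
        \<le> 1 / 4 * (\<Sum>k=0..K. weight (rate \<gamma> \<mu> 1 1) k * (\<integral>t. f (x k t) - f xs \<partial>M))
           + 0 * 0\<^sup>2 + 0 * 0\<^sup>2 + \<gamma> * D3 * weight_sum (rate \<gamma> \<mu> 1 1) K" for K
      using weighted_error_sum[of K] by (simp add: gap_def D3)
  qed (use zero in simp_all)
  moreover have "integrable M (\<lambda>s. f (weighted_avg (rate \<gamma> \<mu> 1 1) x K s) - f xs)" for K
    by (rule jensen_gap(1))
  moreover have "(\<integral>s. f (weighted_avg (rate \<gamma> \<mu> 1 1) x K s) - f xs \<partial>M)
      \<le> (1 - \<gamma> * \<mu> / 2) ^ K * (4 * (norm (x0 - xs))\<^sup>2 / \<gamma>) + 4 * \<gamma> * (D1' + D3)" for K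
  proof -
    have "1 / weight_sum (rate \<gamma> \<mu> 1 1) K * (4 * (norm (x0 - xs))\<^sup>2 / \<gamma>)
        \<le> (1 - rate \<gamma> \<mu> 1 1) ^ K * (4 * (norm (x0 - xs))\<^sup>2 / \<gamma>)"
      using assms(12) by (intro mult_right_mono inverse_weight_sum) auto
    with expected_gap[of K] show ?thesis unfolding D1 D3 rate_eq by linarith
  qed
  moreover have "(\<integral>s. f (weighted_avg (rate \<gamma> \<mu> 1 1) x K s) - f xs \<partial>M)
      \<le> 4 * (norm (x0 - xs))\<^sup>2 / (\<gamma> * real K) + 4 * \<gamma> * (D1' + D3)" if "\<mu> = 0" "K \<ge> 1" for K
  proof -
    have W: "weight_sum (rate \<gamma> \<mu> 1 1) K = real K + 1"
      unfolding rate_eq by (simp add: weight_sum_def weight_eq \<open>\<mu> = 0\<close>)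
    have "1 / (real K + 1) * (4 * (norm (x0 - xs))\<^sup>2 / \<gamma>) \<le> 1 / real K * (4 * (norm (x0 - xs))\<^sup>2 / \<gamma>)"
      using \<open>K \<ge> 1\<close> assms(12) by (intro mult_right_mono divide_left_mono) auto
    also have "\<dots> = 4 * (norm (x0 - xs))\<^sup>2 / (\<gamma> * real K)" by simp
    finally show ?thesis using expected_gap[of K] unfolding W D1 D3 by linarith
  qed
  ultimately show ?thesis by blast
qed

end
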